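(* Let $A\in\mathbb{R}^{n\times n}$ be symmetric positive definite and let $B\in\mathbb{R}^{m\times n}$ with $\operatorname{rank}(B)=m<n$. For $\alpha>0$ let $$\mathcal{A}=\begin{bmatrix}A & B^T\\ -B & 0\end{bmatrix},\qquad \mathcal{P}_{REHSS}=\mathcal{P}_{REHSS}(\alpha)=\begin{bmatrix}A & AB^T\\ -B & \alpha I\end{bmatrix}.$$ (a) For $\alpha>0$, the preconditioned matrix $\mathcal{P}_{REHSS}^{-1}\mathcal{A}$ has eigenvalue $1$ of algebraic multiplicity at least $n$. The remaining $m$ eigenvalues (counted with algebraic multiplicity) are $\mu_1,\dots,\mu_m$, the eigenvalues of the $m\times m$ matrix $\hat A=(\alpha I+BB^T)^{-1}BA^{-1}B^T$. (b) Let $\alpha>0$ and let $(\mu,[x;y])$ be an eigenpair of $\mathcal{P}_{REHSS}^{-1}\mathcal{A}$, with $x\in\mathbb{C}^n$, $y\in\mathbb{C}^m$. Then $x\neq 0$, and $\mu$ is either equal to $1$ or can be written as $\mu=(\alpha\hat b+\hat c)/\hat a$, where $$\hat a=x^*(\alpha I+B^TB)A(\alpha I+B^TB)x,\quad \hat b=x^*(B^TB)x,\quad \hat c=x^*(B^TB)^2x.$$ Moreover, as $\alpha\to0$, $\mu$ is either equal to $1$ or satisfies $$\frac{1}{\mu_{\max}(A)}\le\mu\le\frac{1}{\mu_{\min}(A)},$$ where $\mu_{\min}(A)$ and $\mu_{\max}(A)$ are the smallest and largest eigenvalues of $A$, respectively; that is, whenever $\alpha_k>0$, $\alpha_k\to0$,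 $\mu_k$ is an eigenvalue of $\mathcal{P}_{REHSS}(\alpha_k)^{-1}\mathcal{A}$ for each $k$, and $\mu_k\to\mu$, the limit $\mu$ is either equal to $1$ or lies in $\left[\frac{1}{\mu_{\max}(A)},\frac{1}{\mu_{\min}(A)}\right]$.
   Context: $X^*$ denotes the conjugate transpose of a matrix or vector $X$; $[x;y]$ denotes the column vector obtained by stacking $x$ on top of $y$; an eigenpair $(\mu,v)$ of a matrix consists of an eigenvalue $\mu\in\mathbb{C}$ and a corresponding (nonzero) eigenvector $v$. $I$ denotes the identity matrix of the appropriate size. The matrix $\mathcal{P}_{REHSS}$ (the REHSS preconditioner) is invertible for every $\alpha>0$. *)

theory Defs
  imports
    "Jordan_Normal_Form.Spectral_Radius"
    "Jordan_Normal_Form.Gauss_Jordan_Elimination"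
    "Jordan_Normal_Form.DL_Rank"
begin

definition sym_pos_def :: "nat \<Rightarrow> real mat \<Rightarrow> bool" where
  "sym_pos_def n A \<longleftrightarrow> A \<in> carrier_mat n n \<and> A\<^sup>T = A \<and>
     (\<forall>x \<in> carrier_vec n. x \<noteq> 0\<^sub>v n \<longrightarrow> x \<bullet> (A *\<^sub>v x) > 0)"

text \<open>Unspecified (\<open>the None\<close>) if the matrix is not invertible.\<close>

definition inv_mat :: "'a :: field mat \<Rightarrow> 'a mat" where
  "inv_mat M = the (mat_inverse M)"

definition saddle_mat :: "real mat \<Rightarrow> real mat \<Rightarrow> real mat" where
  "saddle_mat A B =
     four_block_mat A B\<^sup>T (- B) (0\<^sub>m (dim_row B) (dim_row B))"

definition P_REHSS :: "real mat \<Rightarrow> real mat \<Rightarrow> real \<Rightarrow> real mat" where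
  "P_REHSS A B \<alpha> =
     four_block_mat A (A * B\<^sup>T) (- B) (\<alpha> \<cdot>\<^sub>m 1\<^sub>m (dim_row B))"

abbreviation cmat :: "real mat \<Rightarrow> complex mat" where
  "cmat \<equiv> map_mat complex_of_real"

text \<open>The preconditioned matrix and \<open>A_hat\<close> are real, but their eigenvalues and
  eigenvectors are taken over the complex numbers.\<close>

definition precond_mat :: "real mat \<Rightarrow> real mat \<Rightarrow> real \<Rightarrow> complex mat" where
  "precond_mat A B \<alpha> = cmat (inv_mat (P_REHSS A B \<alpha>) * saddle_mat A B)"

definition A_hat :: "real mat \<Rightarrow> real mat \<Rightarrow> real \<Rightarrow> complex mat" where
  "A_hat A B \<alpha> =
     cmat (inv_mat (\<alpha> \<cdot>\<^sub>m 1\<^sub>m (dim_row B) + B * B\<^sup>T) * B * inv_mat A * B\<^sup>T)"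

definition alg_mult :: "complex mat \<Rightarrow> complex \<Rightarrow> nat" where
  "alg_mult M \<mu> = Polynomial.order \<mu> (char_poly M)"

text \<open>All eigenvalues, each repeated according to its algebraic multiplicity.\<close>

definition eigvals :: "complex mat \<Rightarrow> complex multiset" where
  "eigvals M = proots (char_poly M)"

text \<open>The scalar \<open>x\<^sup>* M x\<close>.\<close>

definition quad_form :: "real mat \<Rightarrow> complex vec \<Rightarrow> complex" where
  "quad_form M x = conjugate x \<bullet> (cmat M *\<^sub>v x)"

definition a_hat :: "real mat \<Rightarrow> real mat \<Rightarrow> real \<Rightarrow> complex vec \<Rightarrow> complex" where
  "a_hat A B \<alpha> x =
     (let S = \<alpha> \<cdot>\<^sub>m 1\<^sub>m (dim_col B) + B\<^sup>T * B in quad_form (S * A * S) x)"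

definition b_hat :: "real mat \<Rightarrow> complex vec \<Rightarrow> complex" where
  "b_hat B x = quad_form (B\<^sup>T * B) x"

definition c_hat :: "real mat \<Rightarrow> complex vec \<Rightarrow> complex" where
  "c_hat B x = quad_form ((B\<^sup>T * B) ^\<^sub>m 2) x"

text \<open>A symmetric matrix has only real eigenvalues, so its real spectrum is its whole
  spectrum.\<close>

definition \<mu>_min :: "real mat \<Rightarrow> real" where
  "\<mu>_min A = Min (spectrum A)"

definition \<mu>_max :: "real mat \<Rightarrow> real" where
  "\<mu>_max A = Max (spectrum A)"

end

theory Submission
  imports Defs
begin

text \<open>Write \<open>G\<close> for \<open>\<alpha>I + BB\<^sup>T\<close> and \<open>H\<close> for \<open>BA\<^sup>-\<^sup>1B\<^sup>T\<close>, so that \<open>A_hat\<close> is \<open>G\<^sup>-\<^sup>1H\<close>.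

  The first block column of the saddle point matrix is also the first block column of the
  preconditioner \<open>P\<close>. Hence \<open>P\<^sup>-\<^sup>1\<close> times the saddle point matrix is block upper triangular with
  first block column \<open>[I; 0]\<close>, and solving \<open>P[u; v] = [B\<^sup>T; 0]\<close> block-wise shows that its lower
  right block is \<open>A_hat\<close> (\<open>preconditioned_block_triangular\<close>). The characteristic polynomial
  therefore splits off the factor \<open>(X - 1)\<^sup>n\<close>, which gives the eigenvalue count.

  For an eigenpair with \<open>\<mu> \<noteq> 1\<close>, eliminating \<open>y\<close> from the two block rows leaves
  \<open>Kx = \<mu> A S x\<close> with \<open>K = B\<^sup>TB\<close> and \<open>S = \<alpha>I + K\<close> (\<open>eigenvector_precond_mat_pencil\<close>). Testing
  \<open>S\<close> times this equation against \<open>x\<close> is the claimed formula; its denominator is nonzero because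
  \<open>S A S\<close> is positive definite and \<open>x \<noteq> 0\<close>.

  For the limit, an eigenvalue other than 1 is an eigenvalue of \<open>A_hat\<close>, hence of the symmetric
  pencil \<open>Hv = \<mu> G v\<close>, so it is a quotient of quadratic forms. With \<open>w = B\<^sup>Tv\<close> this quotient is
  \<open>(w\<^sup>*A\<^sup>-\<^sup>1w) / (\<alpha> v\<^sup>*v + w\<^sup>*w)\<close>. Its numerator lies between \<open>1/\<mu>_max A\<close> and \<open>1/\<mu>_min A\<close> times
  \<open>w\<^sup>*w\<close>. Full row rank of \<open>B\<close> makes \<open>w\<^sup>*w\<close> at least \<open>\<sigma> v\<^sup>*v\<close> for some \<open>\<sigma> > 0\<close> independent
  of \<open>\<alpha>\<close>, so the quotient lies between \<open>\<sigma>/(\<alpha>+\<sigma>) \<cdot> 1/\<mu>_max A\<close> and \<open>1/\<mu>_min A\<close>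
  (\<open>eigenvalue_A_hat_bounds\<close>), and these bounds close up to the claimed interval as
  \<open>\<alpha> \<rightarrow> 0\<close>.

  All estimates reduce to real vectors, since a real symmetric form at \<open>a + ib\<close> is the sum of its
  values at \<open>a\<close> and \<open>b\<close> (\<open>quad_form_symmetric\<close>). The comparison of a real form with the extreme
  eigenvalues of its matrix rests on a coercivity argument instead of a diagonalization
  (\<open>coercive_if_psd_and_det_nonzero\<close>, \<open>eigenvalue_lower_bound_imp_form_bound\<close>).\<close>

section \<open>Quadratic forms of real symmetric matrices\<close>

lemma scalar_prod_self_nonneg: "0 \<le> x \<bullet> (x :: real vec)"
  by (auto simp: scalar_prod_def intro!: sum_nonneg)

lemma scalar_prod_self_pos:
  fixes x :: "real vec"
  assumes "x \<in> carrier_vec n" "x \<noteq> 0\<^sub>v n"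
  shows "x \<bullet> x > 0"
proof -
  have "conjugate x = x" by (auto simp: vec_eq_iff)
  then show ?thesis using conjugate_square_greater_0_vec[OF assms(1)] assms(2) by simp
qed

lemma abs_quadratic_form_le:
  fixes M :: "real mat"
  assumes M: "M \<in> carrier_mat n n"
  shows "\<exists>C>0. \<forall>x\<in>carrier_vec n. \<bar>x \<bullet> (M *\<^sub>v x)\<bar> \<le> C * (x \<bullet> x)"
proof -
  define C where "C = (\<Sum>i<n. \<Sum>j<n. \<bar>M $$ (i,j)\<bar>) + 1"
  have "C > 0"
    unfolding C_def by (intro add_nonneg_pos sum_nonneg) auto
  moreover have "\<bar>x \<bullet> (M *\<^sub>v x)\<bar> \<le> C * (x \<bullet> x)" if x: "x \<in> carrier_vec n" for x
  proof -
    have sq: "x $ i * x $ i \<le> x \<bullet> x" if "i < n" for i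
      using x that unfolding scalar_prod_def
      by (auto intro!: member_le_sum[of i "{0..<n}" "\<lambda>i. x $ i * x $ i"])
    have prod: "\<bar>x $ i\<bar> * \<bar>x $ j\<bar> \<le> x \<bullet> x" if "i < n" "j < n" for i j
    proof -
      have "0 \<le> (\<bar>x $ i\<bar> - \<bar>x $ j\<bar>) * (\<bar>x $ i\<bar> - \<bar>x $ j\<bar>)" by simp
      then have "2 * (\<bar>x $ i\<bar> * \<bar>x $ j\<bar>) \<le> x $ i * x $ i + x $ j * x $ j"
        by (simp add: algebra_simps)
      then show ?thesis using sq[OF that(1)] sq[OF that(2)] by linarith
    qed
    have "x \<bullet> (M *\<^sub>v x) = (\<Sum>i<n. \<Sum>j<n. x $ i * (M $$ (i,j) * x $ j))"
      using x M by (auto simp: scalar_prod_def sum_distrib_left lessThan_atLeast0 intro!: sum.cong)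
    also have "\<bar>\<dots>\<bar> \<le> (\<Sum>i<n. \<Sum>j<n. \<bar>x $ i * (M $$ (i,j) * x $ j)\<bar>)"
      by (intro order.trans[OF sum_abs] sum_mono sum_abs)
    also have "\<dots> \<le> (\<Sum>i<n. \<Sum>j<n. \<bar>M $$ (i,j)\<bar> * (x \<bullet> x))"
    proof (intro sum_mono)
      fix i j assume "i \<in> {..<n}" "j \<in> {..<n}"
      then have "\<bar>M $$ (i,j)\<bar> * (\<bar>x $ i\<bar> * \<bar>x $ j\<bar>) \<le> \<bar>M $$ (i,j)\<bar> * (x \<bullet> x)"
        by (intro mult_left_mono prod) auto
      then show "\<bar>x $ i * (M $$ (i,j) * x $ j)\<bar> \<le> \<bar>M $$ (i,j)\<bar> * (x \<bullet> x)"
        by (simp add: abs_mult ac_simps)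
    qed
    also have "\<dots> = (C - 1) * (x \<bullet> x)"
      unfolding C_def by (simp add: sum_distrib_right)
    also have "\<dots> \<le> C * (x \<bullet> x)"
      using scalar_prod_self_nonneg[of x] by (simp add: algebra_simps)
    finally show ?thesis .
  qed
  ultimately show ?thesis by blast
qed

lemma symmetric_scalar_prod:
  fixes M :: "'a :: comm_semiring_0 mat"
  assumes M: "M \<in> carrier_mat n n" "M\<^sup>T = M" and x: "x \<in> carrier_vec n" "y \<in> carrier_vec n"
  shows "(M *\<^sub>v x) \<bullet> y = x \<bullet> (M *\<^sub>v y)"
  using transpose_vec_mult_scalar[OF M(1) x(1) x(2)] comm_scalar_prod[of "M *\<^sub>v x" n y]
    comm_scalar_prod[of "M *\<^sub>v y" n x] M x by auto

lemma transpose_smult_mat: "(t \<cdot>\<^sub>m M)\<^sup>T = t \<cdot>\<^sub>m M\<^sup>T"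
  by (intro eq_matI) auto

lemma inv_mat:
  fixes M :: "'a :: field mat"
  assumes M: "M \<in> carrier_mat n n" and det: "det M \<noteq> 0"
  shows "inv_mat M \<in> carrier_mat n n" "M * inv_mat M = 1\<^sub>m n" "inv_mat M * M = 1\<^sub>m n"
proof -
  obtain K where "mat_inverse M = Some K"
    using mat_inverse(1)[OF M, of "()"] det_non_zero_imp_unit[OF M det, of "()"]
    by (cases "mat_inverse M") auto
  with mat_inverse(2)[OF M this]
  show "inv_mat M \<in> carrier_mat n n" "M * inv_mat M = 1\<^sub>m n" "inv_mat M * M = 1\<^sub>m n"
    unfolding inv_mat_def by auto
qed

text \<open>Evaluate the form of \<open>N\<close> at \<open>x - N\<^sup>-\<^sup>1x / C\<close>, where \<open>C\<close> bounds the form of \<open>N\<^sup>-\<^sup>1\<close>: the cross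
  terms contribute \<open>- 2(x \<bullet> x) / C\<close> and the quadratic term at most \<open>(x \<bullet> x) / C\<close>, so
  nonnegativity already forces \<open>x \<bullet> Nx \<ge> (x \<bullet> x) / C\<close>. This replaces a compactness argument on
  the unit sphere.\<close>

lemma coercive_if_psd_and_det_nonzero:
  fixes N :: "real mat"
  assumes N: "N \<in> carrier_mat n n" and sym: "N\<^sup>T = N" and det: "det N \<noteq> 0"
    and psd: "\<And>x. x \<in> carrier_vec n \<Longrightarrow> 0 \<le> x \<bullet> (N *\<^sub>v x)"
  shows "\<exists>c>0. \<forall>x\<in>carrier_vec n. c * (x \<bullet> x) \<le> x \<bullet> (N *\<^sub>v x)"
proof -
  define K where "K = inv_mat N"
  have K: "K \<in> carrier_mat n n" and NK: "N * K = 1\<^sub>m n"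
    unfolding K_def using inv_mat[OF N det] by auto
  obtain C where C: "C > 0" and bound: "\<And>x. x \<in> carrier_vec n \<Longrightarrow> \<bar>x \<bullet> (K *\<^sub>v x)\<bar> \<le> C * (x \<bullet> x)"
    using abs_quadratic_form_le[OF K] by blast
  have "1 / C * (x \<bullet> x) \<le> x \<bullet> (N *\<^sub>v x)" if x: "x \<in> carrier_vec n" for x
  proof -
    define z where "z = K *\<^sub>v x"
    define s where "s = - (1 / C)"
    have z: "z \<in> carrier_vec n" unfolding z_def using K x by auto
    have Nz: "N *\<^sub>v z = x"
      unfolding z_def using assoc_mult_mat_vec[OF N K x] NK x by simp
    have zNx: "z \<bullet> (N *\<^sub>v x) = x \<bullet> x"
      using symmetric_scalar_prod[OF N sym z x] Nz by simp
    have "0 \<le> (x + s \<cdot>\<^sub>v z) \<bullet> (N *\<^sub>v (x + s \<cdot>\<^sub>v z))"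
      using x z by (intro psd) auto
    also have "N *\<^sub>v (x + s \<cdot>\<^sub>v z) = N *\<^sub>v x + s \<cdot>\<^sub>v x"
      using N x z Nz by (simp add: mult_add_distrib_mat_vec[of N n n] mult_mat_vec[of N n n])
    also have "(x + s \<cdot>\<^sub>v z) \<bullet> (N *\<^sub>v x + s \<cdot>\<^sub>v x)
       = x \<bullet> (N *\<^sub>v x) + s * (x \<bullet> x) + s * (z \<bullet> (N *\<^sub>v x)) + s * s * (z \<bullet> x)"
      using x z N by (simp add: add_scalar_prod_distrib[of _ n] scalar_prod_add_distrib[of _ n] algebra_simps)
    also have "z \<bullet> x = x \<bullet> (K *\<^sub>v x)"
      using x z unfolding z_def by (intro comm_scalar_prod[of _ n])
    finally have "0 \<le> x \<bullet> (N *\<^sub>v x) + 2 * s * (x \<bullet> x) + s * s * (x \<bullet> (K *\<^sub>v x))"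
      using zNx by (simp add: algebra_simps)
    also have "s * s * (x \<bullet> (K *\<^sub>v x)) \<le> s * s * (C * (x \<bullet> x))"
      using bound[OF x] by (intro mult_left_mono) auto
    finally show ?thesis using C unfolding s_def by (simp add: field_simps)
  qed
  then show ?thesis using C by (intro exI[of _ "1 / C"]) auto
qed

lemma scalar_mat_mult_vec:
  fixes x :: "'a :: comm_ring_1 vec"
  assumes "x \<in> carrier_vec n"
  shows "(t \<cdot>\<^sub>m 1\<^sub>m n) *\<^sub>v x = t \<cdot>\<^sub>v x"
  using assms by (intro eq_vecI) (auto simp: scalar_prod_smult_left)

lemma char_matrix_mult_vec:
  fixes M :: "'a :: field mat"
  assumes "M \<in> carrier_mat n n" "x \<in> carrier_vec n"
  shows "char_matrix M t *\<^sub>v x = M *\<^sub>v x + (- t) \<cdot>\<^sub>v x"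
  using assms unfolding char_matrix_def
  by (simp add: add_mult_distrib_mat_vec[of _ n n] scalar_mat_mult_vec)

text \<open>Let \<open>t\<close> be the largest number for which the form of \<open>M - tI\<close> is nonnegative. If \<open>t < l\<close>, then
  \<open>t\<close> is not an eigenvalue, so \<open>M - tI\<close> is invertible and therefore coercive. But then \<open>t\<close> could
  be increased by the coercivity constant.\<close>

lemma eigenvalue_lower_bound_imp_form_bound:
  fixes M :: "real mat"
  assumes M: "M \<in> carrier_mat n n" and sym: "M\<^sup>T = M"
    and ev: "\<And>e. eigenvalue M e \<Longrightarrow> l \<le> e" and x: "x \<in> carrier_vec n"
  shows "l * (x \<bullet> x) \<le> x \<bullet> (M *\<^sub>v x)"
proof (rule ccontr)
  assume neg: "\<not> ?thesis"
  define T where "T = {t. \<forall>y\<in>carrier_vec n. t * (y \<bullet> y) \<le> y \<bullet> (M *\<^sub>v y)}"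
  define t where "t = Sup T"
  have pos: "y \<bullet> y > 0" if "y \<in> carrier_vec n" "y \<noteq> 0\<^sub>v n" for y :: "real vec"
    using scalar_prod_self_pos[OF that] .
  have x0: "x \<noteq> 0\<^sub>v n" using neg M x by auto
  have upper: "s \<le> (y \<bullet> (M *\<^sub>v y)) / (y \<bullet> y)"
    if "s \<in> T" "y \<in> carrier_vec n" "y \<noteq> 0\<^sub>v n" for s y
    using that pos[OF that(2,3)] unfolding T_def by (simp add: field_simps)
  have bdd: "bdd_above T" using upper[OF _ x x0] by (rule bdd_aboveI)
  obtain C where "\<And>y. y \<in> carrier_vec n \<Longrightarrow> \<bar>y \<bullet> (M *\<^sub>v y)\<bar> \<le> C * (y \<bullet> y)"
    using abs_quadratic_form_le[OF M] by blast
  then have "- C \<in> T" unfolding T_def by force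
  then have ne: "T \<noteq> {}" by auto
  have tT: "t \<in> T" unfolding T_def
  proof (intro CollectI ballI)
    fix y :: "real vec" assume y: "y \<in> carrier_vec n"
    show "t * (y \<bullet> y) \<le> y \<bullet> (M *\<^sub>v y)"
    proof (cases "y = 0\<^sub>v n")
      case True then show ?thesis using M by simp
    next
      case False
      have "t \<le> (y \<bullet> (M *\<^sub>v y)) / (y \<bullet> y)"
        unfolding t_def using ne upper[OF _ y False] by (rule cSup_least)
      then show ?thesis using pos[OF y False] by (simp add: field_simps)
    qed
  qed
  have "t \<le> (x \<bullet> (M *\<^sub>v x)) / (x \<bullet> x)" using upper[OF tT x x0] .
  also have "\<dots> < l" using neg pos[OF x x0] by (simp add: field_simps)
  finally have "\<not> eigenvalue M t" using ev by force
  then have det: "det (char_matrix M t) \<noteq> 0" using eigenvalue_det[OF M] by simp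
  have form: "y \<bullet> (char_matrix M t *\<^sub>v y) = y \<bullet> (M *\<^sub>v y) - t * (y \<bullet> y)"
    if "y \<in> carrier_vec n" for y
    using that M by (simp add: char_matrix_mult_vec[of _ n] scalar_prod_add_distrib[of _ n])
  have "(char_matrix M t)\<^sup>T = char_matrix M t"
    using M sym unfolding char_matrix_def
    by (subst transpose_add[of _ n n]) (auto simp: transpose_smult_mat)
  then obtain c where "c > 0"
    and c: "\<And>y. y \<in> carrier_vec n \<Longrightarrow> c * (y \<bullet> y) \<le> y \<bullet> (char_matrix M t *\<^sub>v y)"
    using coercive_if_psd_and_det_nonzero[OF char_matrix_closed[OF M] _ det] tT form
    unfolding T_def by auto
  have "t + c \<in> T" unfolding T_def using c form by (auto simp: algebra_simps)
  then have "t + c \<le> t" unfolding t_def by (rule cSup_upper) (rule bdd)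
  with \<open>c > 0\<close> show False by simp
qed

section \<open>Symmetric positive definite matrices\<close>

lemma sym_pos_defD:
  assumes "sym_pos_def n M"
  shows "M \<in> carrier_mat n n" "M\<^sup>T = M"
    and "\<And>x. x \<in> carrier_vec n \<Longrightarrow> x \<noteq> 0\<^sub>v n \<Longrightarrow> 0 < x \<bullet> (M *\<^sub>v x)"
    and "\<And>x. x \<in> carrier_vec n \<Longrightarrow> 0 \<le> x \<bullet> (M *\<^sub>v x)"
proof -
  show M: "M \<in> carrier_mat n n" "M\<^sup>T = M"
    and pos: "\<And>x. x \<in> carrier_vec n \<Longrightarrow> x \<noteq> 0\<^sub>v n \<Longrightarrow> 0 < x \<bullet> (M *\<^sub>v x)"
    using assms unfolding sym_pos_def_def by auto
  show "0 \<le> x \<bullet> (M *\<^sub>v x)" if "x \<in> carrier_vec n" for x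
    using pos[OF that] M by (cases "x = 0\<^sub>v n") auto
qed

lemma sym_pos_def_det_nonzero:
  assumes "sym_pos_def n M"
  shows "det M \<noteq> 0"
proof
  assume "det M = 0"
  then obtain v where "v \<in> carrier_vec n" "v \<noteq> 0\<^sub>v n" "M *\<^sub>v v = 0\<^sub>v n"
    using det_0_iff_vec_prod_zero_field[OF sym_pos_defD(1)[OF assms]] by blast
  with sym_pos_defD(3)[OF assms, of v] show False by simp
qed

lemma sym_pos_def_inv_mat:
  assumes spd: "sym_pos_def n M"
  shows "sym_pos_def n (inv_mat M)"
proof -
  note M = sym_pos_defD[OF spd]
  note K = inv_mat[OF M(1) sym_pos_def_det_nonzero[OF spd]]
  let ?K = "inv_mat M"
  have "?K\<^sup>T * M = 1\<^sub>m n"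
    using transpose_mult[OF M(1) K(1)] M(2) K(2) by simp
  then have "?K\<^sup>T * (M * ?K) = ?K"
    using K(1) M(1) by (subst assoc_mult_mat[symmetric, of _ n n _ n _ n]) auto
  then have sym: "?K\<^sup>T = ?K" using K by simp
  have "0 < x \<bullet> (?K *\<^sub>v x)" if x: "x \<in> carrier_vec n" "x \<noteq> 0\<^sub>v n" for x
  proof -
    define z where "z = ?K *\<^sub>v x"
    have z: "z \<in> carrier_vec n" and Mz: "M *\<^sub>v z = x"
      using K M(1) x assoc_mult_mat_vec[OF M(1) K(1) x(1)] unfolding z_def by auto
    have "z \<noteq> 0\<^sub>v n" using Mz M(1) x by auto
    then have "0 < z \<bullet> (M *\<^sub>v z)" using M(3) z by blast
    also have "\<dots> = x \<bullet> z" unfolding Mz using x z by (intro comm_scalar_prod[of _ n])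
    finally show ?thesis unfolding z_def .
  qed
  with K(1) sym show ?thesis unfolding sym_pos_def_def by auto
qed

lemma congruence_form:
  fixes C :: "real mat"
  assumes "C \<in> carrier_mat m n" "x \<in> carrier_vec m" and M: "M \<in> carrier_mat n n"
  shows "x \<bullet> ((C * M * C\<^sup>T) *\<^sub>v x) = (C\<^sup>T *\<^sub>v x) \<bullet> (M *\<^sub>v (C\<^sup>T *\<^sub>v x))"
proof -
  have "(C * M * C\<^sup>T) *\<^sub>v x = C *\<^sub>v (M *\<^sub>v (C\<^sup>T *\<^sub>v x))"
    using assms by (simp add: assoc_mult_mat_vec[of _ m n _ m] assoc_mult_mat_vec[of _ m n _ n])
  then show ?thesis
    using transpose_vec_mult_scalar[OF assms(1), of "M *\<^sub>v (C\<^sup>T *\<^sub>v x)" x] assms by simp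
qed

lemma symmetric_congruence:
  fixes C :: "real mat"
  assumes C: "C \<in> carrier_mat m n" and M: "M \<in> carrier_mat n n" "M\<^sup>T = M"
  shows "(C * M * C\<^sup>T)\<^sup>T = C * M * C\<^sup>T"
proof -
  have "(C * M * C\<^sup>T)\<^sup>T = C * (C * M)\<^sup>T"
    using C M by (subst transpose_mult[of _ m n _ m]) auto
  also have "(C * M)\<^sup>T = M * C\<^sup>T"
    using C M by (subst transpose_mult[of _ m n _ n]) auto
  also have "C * (M * C\<^sup>T) = C * M * C\<^sup>T"
    using C M by (simp add: assoc_mult_mat[of _ m n _ n _ m])
  finally show ?thesis .
qed

lemma sym_pos_def_congruence:
  assumes C: "C \<in> carrier_mat m n" and M: "sym_pos_def n M"
    and inj: "\<And>x. x \<in> carrier_vec m \<Longrightarrow> C\<^sup>T *\<^sub>v x = 0\<^sub>v n \<Longrightarrow> x = 0\<^sub>v m"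
  shows "sym_pos_def m (C * M * C\<^sup>T)"
  unfolding sym_pos_def_def
proof (intro conjI ballI impI)
  note D = sym_pos_defD[OF M]
  show "C * M * C\<^sup>T \<in> carrier_mat m m" using C D(1) by auto
  show "(C * M * C\<^sup>T)\<^sup>T = C * M * C\<^sup>T" by (rule symmetric_congruence[OF C D(1,2)])
  fix x :: "real vec" assume x: "x \<in> carrier_vec m" "x \<noteq> 0\<^sub>v m"
  then show "0 < x \<bullet> ((C * M * C\<^sup>T) *\<^sub>v x)"
    using congruence_form[OF C x(1) D(1)] inj[OF x(1)] D(3)[of "C\<^sup>T *\<^sub>v x"] C by auto
qed

lemma sym_pos_def_one: "sym_pos_def n (1\<^sub>m n)"
  using scalar_prod_self_pos unfolding sym_pos_def_def by auto

lemma shifted_mult_vec: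
  fixes M :: "'a :: comm_ring_1 mat"
  assumes "M \<in> carrier_mat n n" "x \<in> carrier_vec n"
  shows "(t \<cdot>\<^sub>m 1\<^sub>m n + M) *\<^sub>v x = t \<cdot>\<^sub>v x + M *\<^sub>v x"
  using assms by (simp add: add_mult_distrib_mat_vec[of _ n n] scalar_mat_mult_vec)

lemma sym_pos_def_shift_gram:
  fixes C :: "real mat"
  assumes C: "C \<in> carrier_mat m n" and t: "t > 0"
  shows "sym_pos_def m (t \<cdot>\<^sub>m 1\<^sub>m m + C * C\<^sup>T)"
  unfolding sym_pos_def_def
proof (intro conjI ballI impI)
  have CC: "C * C\<^sup>T \<in> carrier_mat m m" using C by auto
  have sym: "(C * C\<^sup>T)\<^sup>T = C * C\<^sup>T"
    using symmetric_congruence[OF C one_carrier_mat] C by simp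
  show "t \<cdot>\<^sub>m 1\<^sub>m m + C * C\<^sup>T \<in> carrier_mat m m" using CC by auto
  show "(t \<cdot>\<^sub>m 1\<^sub>m m + C * C\<^sup>T)\<^sup>T = t \<cdot>\<^sub>m 1\<^sub>m m + C * C\<^sup>T"
    using CC sym by (subst transpose_add[of _ m m]) (auto simp: transpose_smult_mat)
  fix x :: "real vec" assume x: "x \<in> carrier_vec m" "x \<noteq> 0\<^sub>v m"
  have "x \<bullet> ((C * C\<^sup>T) *\<^sub>v x) = (C\<^sup>T *\<^sub>v x) \<bullet> (C\<^sup>T *\<^sub>v x)"
    using congruence_form[OF C x(1) one_carrier_mat] C x by simp
  then have "x \<bullet> ((t \<cdot>\<^sub>m 1\<^sub>m m + C * C\<^sup>T) *\<^sub>v x) = t * (x \<bullet> x) + (C\<^sup>T *\<^sub>v x) \<bullet> (C\<^sup>T *\<^sub>v x)"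
    using CC x by (simp add: shifted_mult_vec scalar_prod_add_distrib[of _ m])
  also have "\<dots> > 0"
    using t scalar_prod_self_pos[OF x] scalar_prod_self_nonneg by (intro add_pos_nonneg) auto
  finally show "0 < x \<bullet> ((t \<cdot>\<^sub>m 1\<^sub>m m + C * C\<^sup>T) *\<^sub>v x)" .
qed

text \<open>Full rank supplies \<open>m\<close> linearly independent columns of \<open>B\<close>. They form an invertible \<open>m \<times> m\<close>
  matrix, and the transpose of that matrix annihilates \<open>v\<close> as soon as \<open>B\<^sup>T\<close> does.\<close>

lemma full_row_rank_transpose_injective:
  fixes B :: "'a :: field mat"
  assumes B: "B \<in> carrier_mat m n" and rank: "vec_space.rank m B = m"
    and v: "v \<in> carrier_vec m" and Bv: "B\<^sup>T *\<^sub>v v = 0\<^sub>v n"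
  shows "v = 0\<^sub>v m"
proof -
  interpret vec_space "TYPE('a)" m .
  have "lin_indpt {}" by (simp add: lin_dep_def)
  then obtain S where max: "maximal S (\<lambda>T. T \<subseteq> set (cols B) \<and> lin_indpt T)"
    using maximal_exists_superset[of "set (cols B)" "\<lambda>T. T \<subseteq> set (cols B) \<and> lin_indpt T" "{}"]
    by auto
  then have S: "S \<subseteq> set (cols B)" "lin_indpt S" unfolding maximal_def by auto
  have card: "card S = m" using rank_card_indpt[OF B max] rank by simp
  have "finite S" using S(1) finite_subset by blast
  then obtain xs where xs: "set xs = S" "distinct xs" "length xs = m"
    using finite_distinct_list card distinct_card by metis
  have carr: "set xs \<subseteq> carrier_vec m" using S(1) B xs(1) cols_dim[of B] by auto
  define M where "M = mat_of_cols m xs"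
  have M: "M \<in> carrier_mat m m" unfolding M_def using xs(3) by auto
  have cols: "cols M = xs" unfolding M_def using carr by (rule cols_mat_of_cols)
  have "rank M = m"
    using lin_indpt_full_rank[OF M] cols xs S by simp
  then have det: "det (M\<^sup>T) \<noteq> 0" using det_rank_iff[OF M] det_transpose[OF M] by simp
  have "M\<^sup>T *\<^sub>v v = 0\<^sub>v m"
  proof (rule eq_vecI)
    fix i assume "i < dim_vec (0\<^sub>v m :: 'a vec)"
    then have i: "i < m" by simp
    have "xs ! i \<in> set (cols B)" using i xs S(1) by (metis nth_mem subsetD)
    then obtain j where j: "j < n" "xs ! i = col B j"
      using B by (auto simp: cols_def)
    have "(M\<^sup>T *\<^sub>v v) $ i = col M i \<bullet> v" using i M by simp
    also have "col M i = col B j" using cols i M j(2) by (metis carrier_matD(2) cols_length cols_nth)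
    also have "col B j \<bullet> v = (B\<^sup>T *\<^sub>v v) $ j" using j B by simp
    finally show "(M\<^sup>T *\<^sub>v v) $ i = 0\<^sub>v m $ i" using Bv i j by simp
  qed (use M in auto)
  then show ?thesis
    using det_0_iff_vec_prod_zero_field[of "M\<^sup>T" m] det M v by auto
qed

section \<open>Real symmetric forms at complex vectors\<close>

abbreviation "Re_vec \<equiv> map_vec Re"
abbreviation "Im_vec \<equiv> map_vec Im"

text \<open>The real cross terms \<open>a \<bullet> Mb\<close> and \<open>b \<bullet> Ma\<close> enter the form at \<open>a + ib\<close> with opposite signs and
  cancel by symmetry. Hence every estimate on real vectors carries over to complex ones.\<close>

lemma quad_form_symmetric:
  assumes M: "M \<in> carrier_mat n n" "M\<^sup>T = M" and x: "x \<in> carrier_vec n"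
  shows "quad_form M x = of_real (Re_vec x \<bullet> (M *\<^sub>v Re_vec x) + Im_vec x \<bullet> (M *\<^sub>v Im_vec x))"
proof -
  have form: "v \<bullet> (M *\<^sub>v w) = (\<Sum>i<n. \<Sum>j<n. v $ i * (M $$ (i,j) * w $ j))"
    if "v \<in> carrier_vec n" "w \<in> carrier_vec n" for v w
    using that M by (auto simp: scalar_prod_def sum_distrib_left lessThan_atLeast0 intro!: sum.cong)
  have quad: "quad_form M x = (\<Sum>i<n. \<Sum>j<n. cnj (x $ i) * (of_real (M $$ (i,j)) * x $ j))"
    using x M unfolding quad_form_def
    by (auto simp: scalar_prod_def sum_distrib_left lessThan_atLeast0 intro!: sum.cong)
  have M_sym: "M $$ (i,j) = M $$ (j,i)" if "i < n" "j < n" for i j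
    using M that by (metis carrier_matD index_transpose_mat(1))
  have "(\<Sum>i<n. \<Sum>j<n. Re (x $ i) * (M $$ (i,j) * Im (x $ j)))
      = (\<Sum>j<n. \<Sum>i<n. Re (x $ i) * (M $$ (i,j) * Im (x $ j)))" by (rule sum.swap)
  also have "\<dots> = (\<Sum>i<n. \<Sum>j<n. Im (x $ i) * (M $$ (i,j) * Re (x $ j)))"
    by (intro sum.cong refl) (auto simp: M_sym)
  finally have cross: "(\<Sum>i<n. \<Sum>j<n. Re (x $ i) * (M $$ (i,j) * Im (x $ j))) = \<dots>" .
  show ?thesis
  proof (rule complex_eqI)
    show "Re (quad_form M x) = Re (of_real (Re_vec x \<bullet> (M *\<^sub>v Re_vec x) + Im_vec x \<bullet> (M *\<^sub>v Im_vec x)))"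
      using x unfolding quad by (simp add: form sum.distrib algebra_simps)
    show "Im (quad_form M x) = Im (of_real (Re_vec x \<bullet> (M *\<^sub>v Re_vec x) + Im_vec x \<bullet> (M *\<^sub>v Im_vec x)))"
      using x cross unfolding quad by (simp add: sum_subtractf algebra_simps)
  qed
qed

lemma zero_if_Re_Im_vec_zero:
  assumes "x \<in> carrier_vec n" "Re_vec x = 0\<^sub>v n" "Im_vec x = 0\<^sub>v n"
  shows "x = 0\<^sub>v n"
proof (rule eq_vecI)
  fix i assume "i < dim_vec (0\<^sub>v n :: complex vec)"
  then have i: "i < n" by simp
  have "Re_vec x $ i = 0" "Im_vec x $ i = 0" using assms(2,3) i by auto
  then show "x $ i = 0\<^sub>v n $ i" using i assms(1) by (simp add: complex_eq_iff)
qed (use assms in auto)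

lemma sym_pos_def_Re_Im_pos:
  assumes M: "sym_pos_def n M" and x: "x \<in> carrier_vec n" "x \<noteq> 0\<^sub>v n"
  shows "0 < Re_vec x \<bullet> (M *\<^sub>v Re_vec x) + Im_vec x \<bullet> (M *\<^sub>v Im_vec x)"
proof -
  note D = sym_pos_defD[OF M]
  have c: "Re_vec x \<in> carrier_vec n" "Im_vec x \<in> carrier_vec n" using x by auto
  consider "Re_vec x \<noteq> 0\<^sub>v n" | "Im_vec x \<noteq> 0\<^sub>v n" using zero_if_Re_Im_vec_zero[OF x(1)] x(2) by blast
  then show ?thesis
    using D(3)[OF c(1)] D(3)[OF c(2)] D(4)[OF c(1)] D(4)[OF c(2)] by cases linarith+
qed

lemma quad_form_nonzero:
  assumes "sym_pos_def n M" "x \<in> carrier_vec n" "x \<noteq> 0\<^sub>v n"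
  shows "quad_form M x \<noteq> 0"
  using sym_pos_def_Re_Im_pos[OF assms] quad_form_symmetric[OF sym_pos_defD(1,2)[OF assms(1)] assms(2)]
  by (metis less_irrefl of_real_eq_0_iff)

lemma quad_form_eq_smult:
  assumes "N \<in> carrier_mat n n" "x \<in> carrier_vec n"
    and "cmat M *\<^sub>v x = \<mu> \<cdot>\<^sub>v (cmat N *\<^sub>v x)"
  shows "quad_form M x = \<mu> * quad_form N x"
  using assms unfolding quad_form_def by simp

text \<open>A generalized eigenvalue equals the ratio of the two forms at its eigenvector, which is real and
  inherits any comparison of the forms on real vectors.\<close>

lemma pencil_eigenvalue_bounds:
  assumes G: "sym_pos_def n G" and H: "H \<in> carrier_mat n n" "H\<^sup>T = H"
    and lower: "\<And>a. a \<in> carrier_vec n \<Longrightarrow> c * (a \<bullet> (G *\<^sub>v a)) \<le> a \<bullet> (H *\<^sub>v a)"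
    and upper: "\<And>a. a \<in> carrier_vec n \<Longrightarrow> a \<bullet> (H *\<^sub>v a) \<le> d * (a \<bullet> (G *\<^sub>v a))"
    and y: "y \<in> carrier_vec n" "y \<noteq> 0\<^sub>v n" and eq: "cmat H *\<^sub>v y = \<mu> \<cdot>\<^sub>v (cmat G *\<^sub>v y)"
  shows "\<exists>r\<in>{c..d}. \<mu> = complex_of_real r"
proof -
  define a b where "a = Re_vec y" and "b = Im_vec y"
  have ab: "a \<in> carrier_vec n" "b \<in> carrier_vec n" unfolding a_def b_def using y by auto
  define g where "g = a \<bullet> (G *\<^sub>v a) + b \<bullet> (G *\<^sub>v b)"
  define h where "h = a \<bullet> (H *\<^sub>v a) + b \<bullet> (H *\<^sub>v b)"
  note D = sym_pos_defD[OF G]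
  have g: "g > 0" unfolding g_def a_def b_def by (rule sym_pos_def_Re_Im_pos[OF G y])
  have "complex_of_real h = \<mu> * complex_of_real g"
    using quad_form_eq_smult[OF D(1) y(1) eq]
    unfolding g_def h_def a_def b_def quad_form_symmetric[OF H y(1)] quad_form_symmetric[OF D(1,2) y(1)] .
  then have "\<mu> = complex_of_real (h / g)" using g by (simp add: field_simps)
  moreover have "c * g \<le> h" "h \<le> d * g"
    using lower[OF ab(1)] lower[OF ab(2)] upper[OF ab(1)] upper[OF ab(2)]
    unfolding g_def h_def by (simp_all add: algebra_simps)
  ultimately show ?thesis using g by (intro bexI[of _ "h / g"]) (auto simp: field_simps)
qed

section \<open>Extreme eigenvalues\<close>

lemma eigenvalue_upper_bound_imp_form_bound:
  fixes M :: "real mat"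
  assumes M: "M \<in> carrier_mat n n" and sym: "M\<^sup>T = M"
    and ev: "\<And>e. eigenvalue M e \<Longrightarrow> e \<le> u" and x: "x \<in> carrier_vec n"
  shows "x \<bullet> (M *\<^sub>v x) \<le> u * (x \<bullet> x)"
proof -
  have neg: "(- M) *\<^sub>v y = - (M *\<^sub>v y)" if "y \<in> carrier_vec n" for y
    using that M by (intro eq_vecI) auto
  have "- u \<le> e" if "eigenvalue (- M) e" for e
  proof -
    from that obtain y where y: "y \<in> carrier_vec n" "y \<noteq> 0\<^sub>v n" "- (M *\<^sub>v y) = e \<cdot>\<^sub>v y"
      using M neg unfolding eigenvalue_def eigenvector_def by auto
    have "M *\<^sub>v y = - (e \<cdot>\<^sub>v y)" using y(3) by (metis uminus_uminus_vec)
    also have "\<dots> = (- e) \<cdot>\<^sub>v y" by (intro eq_vecI) auto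
    finally have "eigenvalue M (- e)"
      using y M unfolding eigenvalue_def eigenvector_def by auto
    with ev show ?thesis by force
  qed
  then have "- u * (x \<bullet> x) \<le> x \<bullet> ((- M) *\<^sub>v x)"
    using M sym by (intro eigenvalue_lower_bound_imp_form_bound[OF _ _ _ x]) (auto simp: transpose_uminus)
  then show ?thesis using neg[OF x] M x by simp
qed

text \<open>Without real eigenvalues, every number would vacuously be a lower bound for them and hence for
  the form. In particular, \<open>Min\<close> and \<open>Max\<close> of the spectrum are attained.\<close>

lemma symmetric_has_real_eigenvalue:
  fixes M :: "real mat"
  assumes M: "M \<in> carrier_mat n n" and sym: "M\<^sup>T = M" and n: "n > 0"
  shows "\<exists>e. eigenvalue M e"
proof (rule ccontr)
  assume none: "\<not> ?thesis"
  define x :: "real vec" where "x = unit_vec n 0"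
  have x: "x \<in> carrier_vec n" "x \<bullet> x = 1" using n unfolding x_def by auto
  have "(x \<bullet> (M *\<^sub>v x) + 1) * (x \<bullet> x) \<le> x \<bullet> (M *\<^sub>v x)"
    using none by (intro eigenvalue_lower_bound_imp_form_bound[OF M sym _ x(1)]) auto
  with x(2) show False by simp
qed

lemma sym_pos_def_eigenvalue_pos:
  assumes M: "sym_pos_def n M" and e: "eigenvalue M e"
  shows "e > 0"
proof -
  from e obtain v where v: "v \<in> carrier_vec n" "v \<noteq> 0\<^sub>v n" "M *\<^sub>v v = e \<cdot>\<^sub>v v"
    using sym_pos_defD(1)[OF M] unfolding eigenvalue_def eigenvector_def by auto
  have "0 < e * (v \<bullet> v)" using sym_pos_defD(3)[OF M v(1,2)] v by simp
  then show ?thesis using scalar_prod_self_pos[OF v(1,2)] by (simp add: zero_less_mult_iff)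
qed

lemma eigenvalue_inv_mat:
  fixes M :: "real mat"
  assumes M: "sym_pos_def n M" and e: "eigenvalue (inv_mat M) e"
  shows "eigenvalue M (1 / e)"
proof -
  note D = sym_pos_defD[OF M]
  note K = inv_mat[OF D(1) sym_pos_def_det_nonzero[OF M]]
  have pos: "e > 0" using sym_pos_def_eigenvalue_pos[OF sym_pos_def_inv_mat[OF M] e] .
  from e obtain v where v: "v \<in> carrier_vec n" "v \<noteq> 0\<^sub>v n" "inv_mat M *\<^sub>v v = e \<cdot>\<^sub>v v"
    using K(1) unfolding eigenvalue_def eigenvector_def by auto
  have "v = M *\<^sub>v (inv_mat M *\<^sub>v v)"
    using assoc_mult_mat_vec[OF D(1) K(1) v(1)] K(2) v(1) by simp
  also have "\<dots> = e \<cdot>\<^sub>v (M *\<^sub>v v)" unfolding v(3) by (rule mult_mat_vec[OF D(1) v(1)])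
  finally have "(1 / e) \<cdot>\<^sub>v v = (1 / e) \<cdot>\<^sub>v (e \<cdot>\<^sub>v (M *\<^sub>v v))" by simp
  also have "\<dots> = M *\<^sub>v v" using pos by (simp add: smult_smult_assoc)
  finally show ?thesis using v D(1) unfolding eigenvalue_def eigenvector_def by auto
qed

lemma extreme_eigenvalues:
  assumes M: "sym_pos_def n M" and n: "n > 0"
  shows "0 < \<mu>_min M" "0 < \<mu>_max M"
    and "\<And>e. eigenvalue M e \<Longrightarrow> \<mu>_min M \<le> e" "\<And>e. eigenvalue M e \<Longrightarrow> e \<le> \<mu>_max M"
proof -
  note D = sym_pos_defD[OF M]
  have fin: "finite (spectrum M)" using card_finite_spectrum(1)[OF D(1)] .
  have ne: "spectrum M \<noteq> {}"
    using symmetric_has_real_eigenvalue[OF D(1,2) n] unfolding spectrum_def by auto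
  have pos: "0 < e" if "e \<in> spectrum M" for e
    using sym_pos_def_eigenvalue_pos[OF M] that unfolding spectrum_def by auto
  show "0 < \<mu>_min M" "0 < \<mu>_max M"
    unfolding \<mu>_min_def \<mu>_max_def using Min_in[OF fin ne] Max_in[OF fin ne] pos by auto
  show "\<mu>_min M \<le> e" "e \<le> \<mu>_max M" if "eigenvalue M e" for e
    using that fin unfolding \<mu>_min_def \<mu>_max_def spectrum_def by auto
qed

lemma inv_mat_form_bounds:
  assumes M: "sym_pos_def n M" and n: "n > 0" and x: "x \<in> carrier_vec n"
  shows "1 / \<mu>_max M * (x \<bullet> x) \<le> x \<bullet> (inv_mat M *\<^sub>v x)"
    and "x \<bullet> (inv_mat M *\<^sub>v x) \<le> 1 / \<mu>_min M * (x \<bullet> x)"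
proof -
  note K = sym_pos_defD[OF sym_pos_def_inv_mat[OF M]]
  note ex = extreme_eigenvalues[OF M n]
  have bounds: "1 / \<mu>_max M \<le> e \<and> e \<le> 1 / \<mu>_min M" if e: "eigenvalue (inv_mat M) e" for e
  proof -
    have "e > 0" using sym_pos_def_eigenvalue_pos[OF sym_pos_def_inv_mat[OF M] e] .
    with ex(1,2) have "1 / \<mu>_max M \<le> 1 / (1 / e)" "1 / (1 / e) \<le> 1 / \<mu>_min M"
      using ex(3,4)[OF eigenvalue_inv_mat[OF M e]] by (intro divide_left_mono; simp)+
    then show ?thesis by simp
  qed
  show "1 / \<mu>_max M * (x \<bullet> x) \<le> x \<bullet> (inv_mat M *\<^sub>v x)"
    using bounds by (intro eigenvalue_lower_bound_imp_form_bound[OF K(1,2) _ x]) auto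
  show "x \<bullet> (inv_mat M *\<^sub>v x) \<le> 1 / \<mu>_min M * (x \<bullet> x)"
    using bounds by (intro eigenvalue_upper_bound_imp_form_bound[OF K(1,2) _ x]) auto
qed

section \<open>The preconditioned matrix is block triangular\<close>

text \<open>Kept over the reals, where it can be multiplied with the real blocks and positive definiteness
  of \<open>\<alpha>I + BB\<^sup>T\<close> is available.\<close>
definition A_hat_real :: "real mat \<Rightarrow> real mat \<Rightarrow> real \<Rightarrow> real mat" where
  "A_hat_real A B \<alpha> =
     inv_mat (\<alpha> \<cdot>\<^sub>m 1\<^sub>m (dim_row B) + B * B\<^sup>T) * B * inv_mat A * B\<^sup>T"

lemma A_hat_eq: "A_hat A B \<alpha> = cmat (A_hat_real A B \<alpha>)"
  unfolding A_hat_def A_hat_real_def ..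

lemma A_hat_real_pencil:
  assumes A: "sym_pos_def n A" and B: "B \<in> carrier_mat m n" and \<alpha>: "\<alpha> > 0"
  shows "A_hat_real A B \<alpha> \<in> carrier_mat m m"
    and "(\<alpha> \<cdot>\<^sub>m 1\<^sub>m m + B * B\<^sup>T) * A_hat_real A B \<alpha> = B * inv_mat A * B\<^sup>T"
proof -
  let ?G = "\<alpha> \<cdot>\<^sub>m 1\<^sub>m m + B * B\<^sup>T"
  let ?K = "inv_mat A"
  have K: "?K \<in> carrier_mat n n" using sym_pos_defD(1)[OF sym_pos_def_inv_mat[OF A]] .
  have G: "sym_pos_def m ?G" using sym_pos_def_shift_gram[OF B \<alpha>] .
  note Gi = inv_mat[OF sym_pos_defD(1)[OF G] sym_pos_def_det_nonzero[OF G]]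
  have eq: "A_hat_real A B \<alpha> = inv_mat ?G * (B * ?K * B\<^sup>T)"
    using B K Gi(1) unfolding A_hat_real_def
    by (simp add: assoc_mult_mat[of _ m m _ n _ n] assoc_mult_mat[of _ m m _ n _ m])
  show "A_hat_real A B \<alpha> \<in> carrier_mat m m" unfolding eq using Gi(1) B by auto
  have H: "B * ?K * B\<^sup>T \<in> carrier_mat m m" using B K by auto
  have "?G * (inv_mat ?G * (B * ?K * B\<^sup>T)) = (?G * inv_mat ?G) * (B * ?K * B\<^sup>T)"
    using assoc_mult_mat[OF sym_pos_defD(1)[OF G] Gi(1) H] by simp
  then show "?G * A_hat_real A B \<alpha> = B * ?K * B\<^sup>T"
    unfolding eq using Gi(2) left_mult_one_mat[OF H] by metis
qed

lemma P_REHSS_carrier: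
  assumes "A \<in> carrier_mat n n" "B \<in> carrier_mat m n"
  shows "P_REHSS A B \<alpha> \<in> carrier_mat (n + m) (n + m)"
  using assms unfolding P_REHSS_def by auto

text \<open>Block elimination factors the preconditioner as
  \<open>[A, 0; -B, I] [I, B\<^sup>T; 0, \<alpha>I + BB\<^sup>T]\<close>, with both diagonal blocks \<open>A\<close> and
  \<open>\<alpha>I + BB\<^sup>T\<close> positive definite.\<close>

lemma det_P_REHSS_nonzero:
  assumes A: "sym_pos_def n A" and B: "B \<in> carrier_mat m n" and \<alpha>: "\<alpha> > 0"
  shows "det (P_REHSS A B \<alpha>) \<noteq> 0"
proof -
  let ?G = "\<alpha> \<cdot>\<^sub>m 1\<^sub>m m + B * B\<^sup>T"
  note D = sym_pos_defD[OF A]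
  have G: "sym_pos_def m ?G" using sym_pos_def_shift_gram[OF B \<alpha>] .
  note Gc = sym_pos_defD(1)[OF G]
  let ?L = "four_block_mat A (0\<^sub>m n m) (- B) (1\<^sub>m m)"
  let ?U = "four_block_mat (1\<^sub>m n) B\<^sup>T (0\<^sub>m m n) ?G"
  have "?L * ?U = P_REHSS A B \<alpha>"
    unfolding P_REHSS_def
  proof (subst mult_four_block_mat[of _ n n _ m _ m], goal_cases)
    case 9
    have "- B * B\<^sup>T + ?G = \<alpha> \<cdot>\<^sub>m 1\<^sub>m m" using B by (intro eq_matI) auto
    then show ?case using D(1) B Gc by (intro cong_four_block_mat) auto
  qed (use D(1) B Gc in auto)
  then have "det (P_REHSS A B \<alpha>) = det (?L * ?U)" by simp
  also have "\<dots> = det ?L * det ?U"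
    using D(1) B Gc by (intro det_mult[of _ "n + m"]) (auto intro!: four_block_carrier_mat)
  also have "det ?L = det A"
    using D(1) B by (subst det_four_block_mat_upper_right_zero[of _ n _ m]) auto
  also have "det ?U = det ?G"
    using Gc B by (subst det_four_block_mat_lower_left_zero[of _ n _ m]) auto
  finally show ?thesis
    using sym_pos_def_det_nonzero[OF A] sym_pos_def_det_nonzero[OF G] by simp
qed

text \<open>It suffices to find \<open>X\<close> for which the preconditioner times the block triangular matrix is the
  saddle point matrix. The first block row \<open>AX + AB\<^sup>T A_hat = B\<^sup>T\<close> determines
  \<open>X = A\<^sup>-\<^sup>1B\<^sup>T - B\<^sup>T A_hat\<close>. The second, \<open>\<alpha> A_hat = BX\<close>, is then the defining equation
  \<open>(\<alpha>I + BB\<^sup>T) A_hat = BA\<^sup>-\<^sup>1B\<^sup>T\<close>.\<close>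

lemma preconditioned_block_triangular:
  assumes A: "sym_pos_def n A" and B: "B \<in> carrier_mat m n" and \<alpha>: "\<alpha> > 0"
  shows "\<exists>X\<in>carrier_mat n m. inv_mat (P_REHSS A B \<alpha>) * saddle_mat A B
           = four_block_mat (1\<^sub>m n) X (0\<^sub>m m n) (A_hat_real A B \<alpha>)"
proof -
  let ?P = "P_REHSS A B \<alpha>" and ?K = "inv_mat A" and ?H = "A_hat_real A B \<alpha>"
  let ?G = "\<alpha> \<cdot>\<^sub>m 1\<^sub>m m + B * B\<^sup>T"
  note D = sym_pos_defD[OF A]
  note K = inv_mat[OF D(1) sym_pos_def_det_nonzero[OF A]]
  note H = A_hat_real_pencil[OF A B \<alpha>]
  have P: "?P \<in> carrier_mat (n + m) (n + m)" using P_REHSS_carrier[OF D(1) B] .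
  note Pi = inv_mat[OF P det_P_REHSS_nonzero[OF A B \<alpha>]]
  define X where "X = ?K * B\<^sup>T - B\<^sup>T * ?H"
  have KB: "?K * B\<^sup>T \<in> carrier_mat n m" and BH: "B\<^sup>T * ?H \<in> carrier_mat n m"
    using K(1) B H(1) by auto
  have X: "X \<in> carrier_mat n m" unfolding X_def using BH by (rule minus_carrier_mat)
  let ?T = "four_block_mat (1\<^sub>m n) X (0\<^sub>m m n) ?H"
  have upper: "A * X + (A * B\<^sup>T) * ?H = B\<^sup>T"
  proof -
    have "A * X = A * (?K * B\<^sup>T) - A * (B\<^sup>T * ?H)"
      unfolding X_def by (rule mult_minus_distrib_mat[OF D(1) KB BH])
    also have "A * (?K * B\<^sup>T) = B\<^sup>T"
      using assoc_mult_mat[OF D(1) K(1), of "B\<^sup>T" m] K(2) B by simp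
    also have "A * (B\<^sup>T * ?H) = (A * B\<^sup>T) * ?H"
      using assoc_mult_mat[OF D(1), of "B\<^sup>T" m ?H m] B H(1) by simp
    finally show ?thesis using D(1) B H(1) by (intro eq_matI) auto
  qed
  have lower: "- B * X + (\<alpha> \<cdot>\<^sub>m 1\<^sub>m m) * ?H = 0\<^sub>m m m"
  proof -
    have "B * X = B * (?K * B\<^sup>T) - B * (B\<^sup>T * ?H)"
      unfolding X_def by (rule mult_minus_distrib_mat[OF B KB BH])
    also have "B * (?K * B\<^sup>T) = ?G * ?H"
      using H(2) assoc_mult_mat[OF B K(1), of "B\<^sup>T" m] B by simp
    also have "?G * ?H = (\<alpha> \<cdot>\<^sub>m 1\<^sub>m m) * ?H + (B * B\<^sup>T) * ?H"
      using B H(1) by (intro add_mult_distrib_mat[of _ m m]) auto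
    also have "(B * B\<^sup>T) * ?H = B * (B\<^sup>T * ?H)"
      using assoc_mult_mat[OF B, of "B\<^sup>T" m ?H m] B H(1) by simp
    finally have BX: "B * X = (\<alpha> \<cdot>\<^sub>m 1\<^sub>m m) * ?H + B * (B\<^sup>T * ?H) - B * (B\<^sup>T * ?H)" .
    have c: "B * (B\<^sup>T * ?H) \<in> carrier_mat m m" "(\<alpha> \<cdot>\<^sub>m 1\<^sub>m m) * ?H \<in> carrier_mat m m"
      using B BH H(1) by auto
    then have "B * X = (\<alpha> \<cdot>\<^sub>m 1\<^sub>m m) * ?H"
      unfolding BX by (intro eq_matI) auto
    moreover have "- B * X = - (B * X)" using B X by simp
    ultimately show ?thesis using c(2) by simp
  qed
  have "?P * ?T = saddle_mat A B"
    unfolding P_REHSS_def saddle_mat_def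
  proof (subst mult_four_block_mat[of _ n n _ m _ m], goal_cases)
    case 9
    then show ?case using D(1) B H(1) X upper lower by (intro cong_four_block_mat) auto
  qed (use D(1) B X H(1) in auto)
  then have "inv_mat ?P * saddle_mat A B = inv_mat ?P * (?P * ?T)" by simp
  also have "\<dots> = (inv_mat ?P * ?P) * ?T"
    using H(1) by (subst assoc_mult_mat[OF Pi(1) P]) auto
  also have "\<dots> = ?T" unfolding Pi(3) using H(1) by (intro left_mult_one_mat) auto
  finally show ?thesis using X by blast
qed

lemma char_poly_one_mat: "char_poly (1\<^sub>m n :: 'a :: comm_ring_1 mat) = [:-1, 1:] ^ n"
proof -
  have "upper_triangular (1\<^sub>m n :: 'a mat)" by auto
  moreover have "diag_mat (1\<^sub>m n :: 'a mat) = replicate n 1"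
    by (intro nth_equalityI) (auto simp: diag_mat_def)
  ultimately show ?thesis
    by (subst char_poly_upper_triangular[of _ n]) auto
qed

lemma char_poly_precond_mat:
  assumes A: "sym_pos_def n A" and B: "B \<in> carrier_mat m n" and \<alpha>: "\<alpha> > 0"
  shows "precond_mat A B \<alpha> \<in> carrier_mat (n + m) (n + m)"
    and "A_hat A B \<alpha> \<in> carrier_mat m m"
    and "char_poly (precond_mat A B \<alpha>) = [:-1, 1:] ^ n * char_poly (A_hat A B \<alpha>)"
proof -
  obtain X where X: "X \<in> carrier_mat n m"
    and T: "inv_mat (P_REHSS A B \<alpha>) * saddle_mat A B
      = four_block_mat (1\<^sub>m n) X (0\<^sub>m m n) (A_hat_real A B \<alpha>)"
    using preconditioned_block_triangular[OF A B \<alpha>] by blast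
  note H = A_hat_real_pencil(1)[OF A B \<alpha>]
  show Hc: "A_hat A B \<alpha> \<in> carrier_mat m m" unfolding A_hat_eq using H by simp
  have eq: "precond_mat A B \<alpha> = four_block_mat (1\<^sub>m n) (cmat X) (0\<^sub>m m n) (A_hat A B \<alpha>)"
    unfolding precond_mat_def T A_hat_eq using X H
    by (subst map_four_block_mat[of _ n n _ m _ m]) (auto simp: of_real_hom.mat_hom_one)
  show "precond_mat A B \<alpha> \<in> carrier_mat (n + m) (n + m)" unfolding eq using Hc by auto
  have "char_poly (precond_mat A B \<alpha>) = char_poly (1\<^sub>m n :: complex mat) * char_poly (A_hat A B \<alpha>)"
    using char_poly_factorized[OF Hc] char_poly_factorized[of "1\<^sub>m n" n] X Hc
    by (intro char_poly_0_block[OF eq]) auto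
  then show "char_poly (precond_mat A B \<alpha>) = [:-1, 1:] ^ n * char_poly (A_hat A B \<alpha>)"
    by (simp add: char_poly_one_mat)
qed

lemma repeat_mset_singleton: "repeat_mset k {#a#} = replicate_mset k a"
  by (induction k) auto

lemma eigvals_precond_mat:
  assumes A: "sym_pos_def n A" and B: "B \<in> carrier_mat m n" and \<alpha>: "\<alpha> > 0"
  shows "eigvals (precond_mat A B \<alpha>) = replicate_mset n 1 + eigvals (A_hat A B \<alpha>)"
    and "size (eigvals (A_hat A B \<alpha>)) = m"
    and "alg_mult (precond_mat A B \<alpha>) 1 \<ge> n"
proof -
  note C = char_poly_precond_mat[OF A B \<alpha>]
  have nz: "char_poly M \<noteq> 0" if "M \<in> carrier_mat k k" for M :: "complex mat" and k
    using degree_monic_char_poly[OF that] by auto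
  show eq: "eigvals (precond_mat A B \<alpha>) = replicate_mset n 1 + eigvals (A_hat A B \<alpha>)"
    unfolding eigvals_def C(3) using nz[OF C(2)]
    by (simp add: proots_mult proots_power repeat_mset_singleton)
  show "size (eigvals (A_hat A B \<alpha>)) = m"
    unfolding eigvals_def size_proots_complex using degree_monic_char_poly[OF C(2)] by simp
  have "alg_mult (precond_mat A B \<alpha>) 1 = count (eigvals (precond_mat A B \<alpha>)) 1"
    unfolding alg_mult_def eigvals_def using nz[OF C(1)] by simp
  then show "alg_mult (precond_mat A B \<alpha>) 1 \<ge> n" unfolding eq by simp
qed

lemma eigenvalue_precond_mat_cases:
  assumes A: "sym_pos_def n A" and B: "B \<in> carrier_mat m n" and \<alpha>: "\<alpha> > 0"
    and ev: "eigenvalue (precond_mat A B \<alpha>) \<mu>"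
  shows "\<mu> = 1 \<or> eigenvalue (A_hat A B \<alpha>) \<mu>"
proof -
  note C = char_poly_precond_mat[OF A B \<alpha>]
  show ?thesis
    using ev unfolding eigenvalue_root_char_poly[OF C(1)] eigenvalue_root_char_poly[OF C(2)] C(3)
    by auto
qed

section \<open>Eigenvectors of the preconditioned matrix\<close>

lemma inv_mat_cancel_left:
  assumes "A \<in> carrier_mat n n" "det A \<noteq> 0" and "C \<in> carrier_mat n k"
  shows "A * (inv_mat A * C) = C"
  using assoc_mult_mat[OF assms(1) inv_mat(1)[OF assms(1,2)] assms(3)] inv_mat(2)[OF assms(1,2)] assms(3)
  by simp

lemma cmat_mult_mult_vec:
  assumes "M \<in> carrier_mat k n" "N \<in> carrier_mat n l" "x \<in> carrier_vec l"
  shows "cmat (M * N) *\<^sub>v x = cmat M *\<^sub>v (cmat N *\<^sub>v x)"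
proof -
  have "cmat (M * N) *\<^sub>v x = (cmat M * cmat N) *\<^sub>v x"
    by (simp only: of_real_hom.mat_hom_mult[OF assms(1,2)])
  also have "\<dots> = cmat M *\<^sub>v (cmat N *\<^sub>v x)"
    by (rule assoc_mult_mat_vec[of _ k n _ l]) (use assms in auto)
  finally show ?thesis .
qed

lemma smult_append_vec: "c \<cdot>\<^sub>v (v @\<^sub>v w) = (c \<cdot>\<^sub>v v) @\<^sub>v (c \<cdot>\<^sub>v w)"
  by (intro eq_vecI) auto

text \<open>Multiplying the eigenvalue equation by the preconditioner removes the inverse; what remains are
  its two block rows.\<close>

lemma eigenvector_precond_mat_equations:
  assumes A: "sym_pos_def n A" and B: "B \<in> carrier_mat m n" and \<alpha>: "\<alpha> > 0"
    and x: "x \<in> carrier_vec n" and y: "y \<in> carrier_vec m"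
    and ev: "eigenvector (precond_mat A B \<alpha>) (x @\<^sub>v y) \<mu>"
  shows "cmat A *\<^sub>v x + cmat B\<^sup>T *\<^sub>v y = \<mu> \<cdot>\<^sub>v (cmat A *\<^sub>v x + cmat A *\<^sub>v (cmat B\<^sup>T *\<^sub>v y))"
    and "(\<mu> - 1) \<cdot>\<^sub>v (cmat B *\<^sub>v x) = (\<mu> * complex_of_real \<alpha>) \<cdot>\<^sub>v y"
proof -
  let ?P = "P_REHSS A B \<alpha>" and ?S = "saddle_mat A B" and ?z = "x @\<^sub>v y"
  note D = sym_pos_defD[OF A]
  have P: "?P \<in> carrier_mat (n + m) (n + m)" using P_REHSS_carrier[OF D(1) B] .
  have S: "?S \<in> carrier_mat (n + m) (n + m)" using D(1) B unfolding saddle_mat_def by auto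
  have z: "?z \<in> carrier_vec (n + m)" using x y by auto
  note Pi = inv_mat[OF P det_P_REHSS_nonzero[OF A B \<alpha>]]
  have "cmat ?P * precond_mat A B \<alpha> = cmat ?S"
    unfolding precond_mat_def
    using inv_mat_cancel_left[OF P det_P_REHSS_nonzero[OF A B \<alpha>] S] Pi(1) S
    by (metis P mult_carrier_mat of_real_hom.mat_hom_mult)
  moreover have "precond_mat A B \<alpha> *\<^sub>v ?z = \<mu> \<cdot>\<^sub>v ?z"
    using ev unfolding eigenvector_def by simp
  ultimately have eq: "cmat ?S *\<^sub>v ?z = \<mu> \<cdot>\<^sub>v (cmat ?P *\<^sub>v ?z)"
    using P z assoc_mult_mat_vec[of "cmat ?P" "n + m" "n + m" "precond_mat A B \<alpha>" "n + m" ?z]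
      char_poly_precond_mat(1)[OF A B \<alpha>] mult_mat_vec[of "cmat ?P" "n + m" "n + m" ?z \<mu>]
    by simp
  have cS: "cmat ?S = four_block_mat (cmat A) (cmat B\<^sup>T) (cmat (- B)) (0\<^sub>m m m)"
    unfolding saddle_mat_def using D(1) B by (subst map_four_block_mat[of _ n n _ m _ m]) auto
  have cP: "cmat ?P = four_block_mat (cmat A) (cmat A * cmat B\<^sup>T) (cmat (- B)) (complex_of_real \<alpha> \<cdot>\<^sub>m 1\<^sub>m m)"
    unfolding P_REHSS_def using D(1) B
    by (subst map_four_block_mat[of _ n n _ m _ m])
      (auto simp: of_real_hom.mat_hom_mult[of _ n n _ m] intro!: cong_four_block_mat eq_matI)
  have neg: "cmat (- B) *\<^sub>v x = - (cmat B *\<^sub>v x)"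
    using B x by (intro eq_vecI) (auto simp: scalar_prod_def sum_negf)
  have Ac: "cmat A \<in> carrier_mat n n" and Bc: "cmat B \<in> carrier_mat m n"
    and Btc: "cmat B\<^sup>T \<in> carrier_mat n m" and nBc: "cmat (- B) \<in> carrier_mat m n"
    using D(1) B by auto
  have "cmat ?S *\<^sub>v ?z = (cmat A *\<^sub>v x + cmat B\<^sup>T *\<^sub>v y) @\<^sub>v (- (cmat B *\<^sub>v x) + 0\<^sub>m m m *\<^sub>v y)"
    unfolding cS neg[symmetric] by (rule four_block_mat_mult_vec[OF Ac Btc nBc zero_carrier_mat x y])
  also have "- (cmat B *\<^sub>v x) + 0\<^sub>m m m *\<^sub>v y = - (cmat B *\<^sub>v x)"
    using Bc x y by (intro eq_vecI) auto
  finally have eqS: "cmat ?S *\<^sub>v ?z = (cmat A *\<^sub>v x + cmat B\<^sup>T *\<^sub>v y) @\<^sub>v - (cmat B *\<^sub>v x)" .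
  have "cmat ?P *\<^sub>v ?z = (cmat A *\<^sub>v x + (cmat A * cmat B\<^sup>T) *\<^sub>v y) @\<^sub>v
      (- (cmat B *\<^sub>v x) + (complex_of_real \<alpha> \<cdot>\<^sub>m 1\<^sub>m m) *\<^sub>v y)"
    unfolding cP neg[symmetric]
    by (rule four_block_mat_mult_vec[OF Ac mult_carrier_mat[OF Ac Btc] nBc _ x y]) auto
  also have "(complex_of_real \<alpha> \<cdot>\<^sub>m 1\<^sub>m m) *\<^sub>v y = complex_of_real \<alpha> \<cdot>\<^sub>v y"
    using y by (rule scalar_mat_mult_vec)
  also have "(cmat A * cmat B\<^sup>T) *\<^sub>v y = cmat A *\<^sub>v (cmat B\<^sup>T *\<^sub>v y)"
    by (rule assoc_mult_mat_vec[OF Ac Btc y])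
  finally have "\<mu> \<cdot>\<^sub>v (cmat ?P *\<^sub>v ?z) = (\<mu> \<cdot>\<^sub>v (cmat A *\<^sub>v x + cmat A *\<^sub>v (cmat B\<^sup>T *\<^sub>v y))) @\<^sub>v
      (\<mu> \<cdot>\<^sub>v (- (cmat B *\<^sub>v x) + complex_of_real \<alpha> \<cdot>\<^sub>v y))"
    by (simp only: smult_append_vec)
  with eq eqS have "(cmat A *\<^sub>v x + cmat B\<^sup>T *\<^sub>v y) @\<^sub>v - (cmat B *\<^sub>v x) =
     (\<mu> \<cdot>\<^sub>v (cmat A *\<^sub>v x + cmat A *\<^sub>v (cmat B\<^sup>T *\<^sub>v y))) @\<^sub>v
      (\<mu> \<cdot>\<^sub>v (- (cmat B *\<^sub>v x) + complex_of_real \<alpha> \<cdot>\<^sub>v y))" by (simp only:)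
  then have "cmat A *\<^sub>v x + cmat B\<^sup>T *\<^sub>v y = \<mu> \<cdot>\<^sub>v (cmat A *\<^sub>v x + cmat A *\<^sub>v (cmat B\<^sup>T *\<^sub>v y)) \<and>
    - (cmat B *\<^sub>v x) = \<mu> \<cdot>\<^sub>v (- (cmat B *\<^sub>v x) + complex_of_real \<alpha> \<cdot>\<^sub>v y)"
    by (rule iffD1[OF append_vec_eq[of _ n], rotated 2]) (use Ac Btc x y in auto)
  then have 1: "cmat A *\<^sub>v x + cmat B\<^sup>T *\<^sub>v y = \<mu> \<cdot>\<^sub>v (cmat A *\<^sub>v x + cmat A *\<^sub>v (cmat B\<^sup>T *\<^sub>v y))"
    and 2: "- (cmat B *\<^sub>v x) = \<mu> \<cdot>\<^sub>v (- (cmat B *\<^sub>v x) + complex_of_real \<alpha> \<cdot>\<^sub>v y)"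
    by blast+
  show "cmat A *\<^sub>v x + cmat B\<^sup>T *\<^sub>v y = \<mu> \<cdot>\<^sub>v (cmat A *\<^sub>v x + cmat A *\<^sub>v (cmat B\<^sup>T *\<^sub>v y))" by (rule 1)
  show "(\<mu> - 1) \<cdot>\<^sub>v (cmat B *\<^sub>v x) = (\<mu> * complex_of_real \<alpha>) \<cdot>\<^sub>v y"
  proof (rule eq_vecI)
    fix i assume "i < dim_vec ((\<mu> * complex_of_real \<alpha>) \<cdot>\<^sub>v y)"
    then have i: "i < m" using y by simp
    define b where "b = (cmat B *\<^sub>v x) $ i"
    have "- b = \<mu> * (- b + complex_of_real \<alpha> * y $ i)"
      using arg_cong[OF 2, of "\<lambda>v. v $ i"] i Bc y unfolding b_def by simp
    then have "(\<mu> - 1) * b = \<mu> * complex_of_real \<alpha> * y $ i" by (simp add: algebra_simps)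
    then show "((\<mu> - 1) \<cdot>\<^sub>v (cmat B *\<^sub>v x)) $ i = ((\<mu> * complex_of_real \<alpha>) \<cdot>\<^sub>v y) $ i"
      using i Bc y unfolding b_def by simp
  qed (use Bc y in auto)
qed

lemma sym_pos_def_gram:
  fixes B :: "real mat"
  assumes B: "B \<in> carrier_mat m n" and rank: "vec_space.rank m B = m"
  shows "sym_pos_def m (B * B\<^sup>T)"
  using sym_pos_def_congruence[OF B sym_pos_def_one] full_row_rank_transpose_injective[OF B rank] B
  by simp

text \<open>If \<open>x = 0\<close>, the second block row says \<open>\<mu>\<alpha>y = 0\<close>. So either \<open>y = 0\<close>, or \<open>\<mu> = 0\<close> and the
  first block row says \<open>B\<^sup>Ty = 0\<close>, which also forces \<open>y = 0\<close> by full row rank.\<close>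

lemma eigenvector_precond_mat_fst_nonzero:
  assumes A: "sym_pos_def n A" and B: "B \<in> carrier_mat m n" and rank: "vec_space.rank m B = m"
    and \<alpha>: "\<alpha> > 0" and x: "x \<in> carrier_vec n" and y: "y \<in> carrier_vec m"
    and ev: "eigenvector (precond_mat A B \<alpha>) (x @\<^sub>v y) \<mu>"
  shows "x \<noteq> 0\<^sub>v n"
proof
  assume x0: "x = 0\<^sub>v n"
  note E = eigenvector_precond_mat_equations[OF A B \<alpha> x y ev]
  note D = sym_pos_defD[OF A]
  note G = sym_pos_def_gram[OF B rank]
  have Ac: "cmat A \<in> carrier_mat n n" and Bc: "cmat B \<in> carrier_mat m n"
    and Btc: "cmat B\<^sup>T \<in> carrier_mat n m"
    using D(1) B by auto
  have "x @\<^sub>v y = 0\<^sub>v (n + m)" if "y = 0\<^sub>v m"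
    unfolding x0 that by (intro eq_vecI) auto
  moreover have "x @\<^sub>v y \<noteq> 0\<^sub>v (n + m)"
    using ev char_poly_precond_mat(1)[OF A B \<alpha>] unfolding eigenvector_def by auto
  ultimately have "y \<noteq> 0\<^sub>v m" by blast
  moreover have "y = 0\<^sub>v m"
  proof (cases "\<mu> = 0")
    case True
    have "cmat B\<^sup>T *\<^sub>v y = cmat A *\<^sub>v x + cmat B\<^sup>T *\<^sub>v y"
      unfolding x0 using Ac Btc by (intro eq_vecI) auto
    also have "\<dots> = 0\<^sub>v n"
      unfolding E(1) True using Ac by (intro eq_vecI) auto
    finally have "cmat B\<^sup>T *\<^sub>v y = 0\<^sub>v n" .
    then have "cmat B *\<^sub>v (cmat B\<^sup>T *\<^sub>v y) = cmat B *\<^sub>v 0\<^sub>v n" by (rule arg_cong)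
    also have "\<dots> = 0\<^sub>v m" using Bc by (intro eq_vecI) auto
    finally have "cmat B *\<^sub>v (cmat B\<^sup>T *\<^sub>v y) = 0\<^sub>v m" .
    then have "cmat (B * B\<^sup>T) *\<^sub>v y = 0\<^sub>v m"
      using cmat_mult_mult_vec[of B m n "B\<^sup>T" m y] B y by simp
    then have "quad_form (B * B\<^sup>T) y = 0" using y unfolding quad_form_def by simp
    then show ?thesis using quad_form_nonzero[OF G y] by blast
  next
    case False
    have "(\<mu> * complex_of_real \<alpha>) \<cdot>\<^sub>v y = (\<mu> - 1) \<cdot>\<^sub>v (cmat B *\<^sub>v 0\<^sub>v n)"
      using E(2) unfolding x0 by (rule sym)
    also have "\<dots> = 0\<^sub>v m" using Bc by (intro eq_vecI) auto
    finally have zero: "(\<mu> * complex_of_real \<alpha>) \<cdot>\<^sub>v y = 0\<^sub>v m" .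
    show ?thesis
    proof (rule eq_vecI)
      fix i assume "i < dim_vec (0\<^sub>v m :: complex vec)"
      then show "y $ i = 0\<^sub>v m $ i"
        using arg_cong[OF zero, of "\<lambda>v. v $ i"] False \<alpha> y by simp
    qed (use y in auto)
  qed
  ultimately show False by contradiction
qed

lemma cmat_add:
  assumes "M \<in> carrier_mat n n" "N \<in> carrier_mat n n"
  shows "cmat (M + N) = cmat M + cmat N"
  using assms by (intro eq_matI) auto

lemma quad_form_add:
  assumes "M \<in> carrier_mat n n" "N \<in> carrier_mat n n" "x \<in> carrier_vec n"
  shows "quad_form (M + N) x = quad_form M x + quad_form N x"
  using assms unfolding quad_form_def
  by (simp add: cmat_add[of _ n] add_mult_distrib_mat_vec[of _ n n] scalar_prod_add_distrib[of _ n])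

lemma quad_form_smult:
  assumes "M \<in> carrier_mat n n" "x \<in> carrier_vec n"
  shows "quad_form (t \<cdot>\<^sub>m M) x = of_real t * quad_form M x"
proof -
  have "cmat (t \<cdot>\<^sub>m M) *\<^sub>v x = of_real t \<cdot>\<^sub>v (cmat M *\<^sub>v x)"
    using assms by (intro eq_vecI) (auto simp: scalar_prod_def sum_distrib_left ac_simps)
  then show ?thesis using quad_form_eq_smult[OF assms, of "t \<cdot>\<^sub>m M" "of_real t"] by simp
qed

lemma cmat_shifted_mult_vec:
  assumes "K \<in> carrier_mat n n" "x \<in> carrier_vec n"
  shows "cmat (t \<cdot>\<^sub>m 1\<^sub>m n + K) *\<^sub>v x = of_real t \<cdot>\<^sub>v x + cmat K *\<^sub>v x"
proof -
  have "cmat (t \<cdot>\<^sub>m 1\<^sub>m n + K) = of_real t \<cdot>\<^sub>m 1\<^sub>m n + cmat K"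
    using assms by (intro eq_matI) auto
  then show ?thesis using assms by (simp add: shifted_mult_vec)
qed

text \<open>Applying \<open>B\<^sup>T\<close> and \<open>AB\<^sup>T\<close> to the second block row expresses \<open>\<mu>\<alpha>B\<^sup>Ty\<close> and
  \<open>\<mu>\<alpha>AB\<^sup>Ty\<close> through \<open>x\<close>. Substituting this into the first row eliminates \<open>y\<close> up to
  a factor \<open>\<mu> - 1\<close>. No division by \<open>\<mu>\<close> takes place, so \<open>\<mu> = 0\<close> needs no special treatment.\<close>

lemma eigenvector_precond_mat_pencil:
  assumes A: "sym_pos_def n A" and B: "B \<in> carrier_mat m n"
    and \<alpha>: "\<alpha> > 0" and x: "x \<in> carrier_vec n" and y: "y \<in> carrier_vec m"
    and ev: "eigenvector (precond_mat A B \<alpha>) (x @\<^sub>v y) \<mu>" and \<mu>: "\<mu> \<noteq> 1"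
  defines "K \<equiv> B\<^sup>T * B"
  shows "cmat K *\<^sub>v x = \<mu> \<cdot>\<^sub>v (cmat A *\<^sub>v (cmat (\<alpha> \<cdot>\<^sub>m 1\<^sub>m n + K) *\<^sub>v x))"
proof -
  note E = eigenvector_precond_mat_equations[OF A B \<alpha> x y ev]
  note D = sym_pos_defD[OF A]
  have Ac: "cmat A \<in> carrier_mat n n" and Bc: "cmat B \<in> carrier_mat m n"
    and Btc: "cmat B\<^sup>T \<in> carrier_mat n m"
    using D(1) B by auto
  have K: "K \<in> carrier_mat n n" unfolding K_def using B by auto
  have Kx: "cmat K *\<^sub>v x = cmat B\<^sup>T *\<^sub>v (cmat B *\<^sub>v x)"
    unfolding K_def by (rule cmat_mult_mult_vec[of _ n m _ n]) (use B x in auto)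
  define p q k where "p = cmat A *\<^sub>v x" and "q = cmat B\<^sup>T *\<^sub>v y" and "k = cmat K *\<^sub>v x"
  have c: "p \<in> carrier_vec n" "q \<in> carrier_vec n" "k \<in> carrier_vec n"
    unfolding p_def q_def k_def using Ac Btc K x y by auto
  have kq: "(\<mu> - 1) \<cdot>\<^sub>v k = (\<mu> * complex_of_real \<alpha>) \<cdot>\<^sub>v q"
    using arg_cong[OF E(2), of "\<lambda>v. cmat B\<^sup>T *\<^sub>v v"] Btc Bc x y
    unfolding k_def q_def Kx by (simp add: mult_mat_vec[of _ n m])
  have sr: "(\<mu> - 1) \<cdot>\<^sub>v (cmat A *\<^sub>v k) = (\<mu> * complex_of_real \<alpha>) \<cdot>\<^sub>v (cmat A *\<^sub>v q)"
    using arg_cong[OF kq, of "\<lambda>v. cmat A *\<^sub>v v"] Ac c by (simp add: mult_mat_vec[of _ n n])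
  have "cmat A *\<^sub>v (cmat (\<alpha> \<cdot>\<^sub>m 1\<^sub>m n + K) *\<^sub>v x) = of_real \<alpha> \<cdot>\<^sub>v p + cmat A *\<^sub>v k"
    unfolding cmat_shifted_mult_vec[OF K x] p_def k_def
    using Ac K x by (simp add: mult_add_distrib_mat_vec[of _ n n] mult_mat_vec[of _ n n])
  moreover have "k = \<mu> \<cdot>\<^sub>v (of_real \<alpha> \<cdot>\<^sub>v p + cmat A *\<^sub>v k)"
  proof (rule eq_vecI)
    fix i assume "i < dim_vec (\<mu> \<cdot>\<^sub>v (of_real \<alpha> \<cdot>\<^sub>v p + cmat A *\<^sub>v k))"
    then have i: "i < n" using Ac by simp
    define a where "a = complex_of_real \<alpha>"
    define s r where "s = (cmat A *\<^sub>v k) $ i" and "r = (cmat A *\<^sub>v q) $ i"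
    have 1: "p $ i + q $ i = \<mu> * (p $ i + r)"
      using arg_cong[OF E(1)[folded p_def q_def], of "\<lambda>v. v $ i"] i Ac c unfolding r_def by simp
    have 2: "(\<mu> - 1) * k $ i = \<mu> * a * q $ i"
      using arg_cong[OF kq, of "\<lambda>v. v $ i"] i c unfolding a_def by simp
    have 3: "(\<mu> - 1) * s = \<mu> * a * r"
      using arg_cong[OF sr, of "\<lambda>v. v $ i"] i Ac unfolding a_def s_def r_def by simp
    have "(\<mu> - 1) * k $ i = (\<mu> - 1) * (\<mu> * (a * p $ i + s))"
    proof -
      have "q $ i = \<mu> * (p $ i + r) - p $ i" using 1 by (metis add_diff_cancel_left')
      then have "a * q $ i = a * (\<mu> * (p $ i + r) - p $ i)" by (rule arg_cong)
      also have "\<dots> = (\<mu> - 1) * (a * p $ i) + \<mu> * a * r" by (simp add: algebra_simps)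
      also have "\<dots> = (\<mu> - 1) * (a * p $ i + s)" unfolding 3[symmetric] by (simp add: algebra_simps)
      finally show ?thesis unfolding 2 by (simp add: ac_simps)
    qed
    then have "k $ i = \<mu> * (a * p $ i + s)" using \<mu> by simp
    then show "k $ i = (\<mu> \<cdot>\<^sub>v (of_real \<alpha> \<cdot>\<^sub>v p + cmat A *\<^sub>v k)) $ i"
      using i Ac c unfolding s_def a_def by simp
  qed (use Ac c in auto)
  ultimately show ?thesis unfolding k_def by simp
qed

text \<open>Apply \<open>S = \<alpha>I + K\<close> to \<open>Kx = \<mu> A S x\<close> and test against \<open>x\<close>: since \<open>S K = \<alpha>K + K\<^sup>2\<close>,
  the left-hand side becomes \<open>\<alpha> b_hat + c_hat\<close> and the right-hand side \<open>\<mu> a_hat\<close>.\<close>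

lemma eigenvalue_formula:
  assumes A: "sym_pos_def n A" and B: "B \<in> carrier_mat m n"
    and \<alpha>: "\<alpha> > 0" and x: "x \<in> carrier_vec n" "x \<noteq> 0\<^sub>v n" and y: "y \<in> carrier_vec m"
    and ev: "eigenvector (precond_mat A B \<alpha>) (x @\<^sub>v y) \<mu>" and \<mu>: "\<mu> \<noteq> 1"
  shows "a_hat A B \<alpha> x \<noteq> 0"
    and "\<mu> = (complex_of_real \<alpha> * b_hat B x + c_hat B x) / a_hat A B \<alpha> x"
proof -
  define K where "K = B\<^sup>T * B"
  define S where "S = \<alpha> \<cdot>\<^sub>m 1\<^sub>m n + K"
  note D = sym_pos_defD[OF A]
  have S_spd: "sym_pos_def n S"
    using sym_pos_def_shift_gram[of "B\<^sup>T" n m \<alpha>] B \<alpha> unfolding S_def K_def by simp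
  note S = sym_pos_defD[OF S_spd]
  have K: "K \<in> carrier_mat n n" unfolding K_def using B by auto
  have SAS: "sym_pos_def n (S * A * S)"
  proof -
    have "v = 0\<^sub>v n" if "v \<in> carrier_vec n" "S\<^sup>T *\<^sub>v v = 0\<^sub>v n" for v
      using S(2) S(3)[OF that(1)] that by auto
    from sym_pos_def_congruence[OF S(1) A this] show ?thesis using S(2) by simp
  qed
  have a_hat: "a_hat A B \<alpha> x = quad_form (S * A * S) x"
    using B unfolding a_hat_def Let_def S_def K_def by simp
  show nz: "a_hat A B \<alpha> x \<noteq> 0" unfolding a_hat by (rule quad_form_nonzero[OF SAS x])
  have Ac: "cmat A \<in> carrier_mat n n" and Sc: "cmat S \<in> carrier_mat n n" and Kc: "cmat K \<in> carrier_mat n n"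
    using D(1) S(1) K by auto
  have pencil: "cmat K *\<^sub>v x = \<mu> \<cdot>\<^sub>v (cmat A *\<^sub>v (cmat S *\<^sub>v x))"
    using eigenvector_precond_mat_pencil[OF A B \<alpha> x(1) y ev \<mu>] unfolding S_def K_def .
  have SASx: "cmat (S * A * S) *\<^sub>v x = cmat S *\<^sub>v (cmat A *\<^sub>v (cmat S *\<^sub>v x))"
    using D(1) S(1) x(1) cmat_mult_mult_vec[of S n n A n "cmat S *\<^sub>v x"]
      cmat_mult_mult_vec[of "S * A" n n S n x] by simp
  have "cmat (\<alpha> \<cdot>\<^sub>m K + K ^\<^sub>m 2) *\<^sub>v x = cmat S *\<^sub>v (cmat K *\<^sub>v x)"
  proof -
    have "\<alpha> \<cdot>\<^sub>m K + K ^\<^sub>m 2 = S * K"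
      unfolding S_def using K mult_smult_assoc_mat[of "1\<^sub>m n" n n K n \<alpha>]
      by (simp add: numeral_2_eq_2 add_mult_distrib_mat[of _ n n])
    then show ?thesis using cmat_mult_mult_vec[OF S(1) K x(1)] by simp
  qed
  also have "\<dots> = \<mu> \<cdot>\<^sub>v (cmat (S * A * S) *\<^sub>v x)"
    unfolding pencil SASx using Ac Sc x(1) by (simp add: mult_mat_vec[of _ n n])
  finally have "quad_form (\<alpha> \<cdot>\<^sub>m K + K ^\<^sub>m 2) x = \<mu> * quad_form (S * A * S) x"
    by (rule quad_form_eq_smult[OF sym_pos_defD(1)[OF SAS] x(1)])
  moreover have "quad_form (\<alpha> \<cdot>\<^sub>m K + K ^\<^sub>m 2) x = complex_of_real \<alpha> * b_hat B x + c_hat B x"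
    using K x(1) unfolding b_hat_def c_hat_def K_def[symmetric]
    by (simp add: quad_form_add[of _ n] quad_form_smult[of _ n] pow_carrier_mat)
  ultimately show "\<mu> = (complex_of_real \<alpha> * b_hat B x + c_hat B x) / a_hat A B \<alpha> x"
    using nz unfolding a_hat by (simp add: field_simps)
qed

section \<open>Eigenvalues for small \<open>\<alpha>\<close>\<close>

text \<open>With \<open>w = B\<^sup>Ta\<close>, the forms of \<open>H\<close> and \<open>G\<close> at \<open>a\<close> are \<open>w \<bullet> A\<^sup>-\<^sup>1w\<close> and
  \<open>\<alpha>(a \<bullet> a) + w \<bullet> w\<close>. The shift by \<open>\<alpha>\<close> can only decrease the quotient, which gives the upper
  bound. The assumption on \<open>\<sigma>\<close> says \<open>\<sigma>(a \<bullet> a) \<le> w \<bullet> w\<close>, so the shift costs at most the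
  factor \<open>\<sigma> / (\<alpha> + \<sigma>)\<close>.\<close>
lemma eigenvalue_A_hat_bounds:
  assumes A: "sym_pos_def n A" and n: "n > 0" and B: "B \<in> carrier_mat m n"
    and \<sigma>: "\<sigma> > 0" "\<And>v. v \<in> carrier_vec m \<Longrightarrow> \<sigma> * (v \<bullet> v) \<le> v \<bullet> ((B * B\<^sup>T) *\<^sub>v v)"
    and \<alpha>: "\<alpha> > 0" and ev: "eigenvalue (A_hat A B \<alpha>) \<mu>"
  shows "\<exists>r\<in>{\<sigma> / (\<alpha> + \<sigma>) * (1 / \<mu>_max A) .. 1 / \<mu>_min A}. \<mu> = complex_of_real r"
proof -
  define G where "G = \<alpha> \<cdot>\<^sub>m 1\<^sub>m m + B * B\<^sup>T"
  define H where "H = B * inv_mat A * B\<^sup>T"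
  note K = sym_pos_defD[OF sym_pos_def_inv_mat[OF A]]
  note P = A_hat_real_pencil[OF A B \<alpha>, folded G_def H_def]
  note ex = extreme_eigenvalues(1,2)[OF A n]
  have G: "sym_pos_def m G" unfolding G_def by (rule sym_pos_def_shift_gram[OF B \<alpha>])
  note Gc = sym_pos_defD(1)[OF G]
  have H: "H \<in> carrier_mat m m" "H\<^sup>T = H"
    unfolding H_def using B K(1) symmetric_congruence[OF B K(1,2)] by auto
  obtain y where y: "y \<in> carrier_vec m" "y \<noteq> 0\<^sub>v m" and Ay: "cmat (A_hat_real A B \<alpha>) *\<^sub>v y = \<mu> \<cdot>\<^sub>v y"
    using ev P(1) unfolding A_hat_eq eigenvalue_def eigenvector_def by auto
  have "cmat H *\<^sub>v y = cmat G *\<^sub>v (cmat (A_hat_real A B \<alpha>) *\<^sub>v y)"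
    unfolding P(2)[symmetric] by (rule cmat_mult_mult_vec[OF Gc P(1) y(1)])
  then have eq: "cmat H *\<^sub>v y = \<mu> \<cdot>\<^sub>v (cmat G *\<^sub>v y)"
    unfolding Ay using Gc y(1) by (simp add: mult_mat_vec[of _ m m])
  have forms: "\<sigma> / (\<alpha> + \<sigma>) * (1 / \<mu>_max A) * (a \<bullet> (G *\<^sub>v a)) \<le> a \<bullet> (H *\<^sub>v a)"
    "a \<bullet> (H *\<^sub>v a) \<le> 1 / \<mu>_min A * (a \<bullet> (G *\<^sub>v a))" if a: "a \<in> carrier_vec m" for a
  proof -
    define w where "w = B\<^sup>T *\<^sub>v a"
    have w: "w \<in> carrier_vec n" unfolding w_def using B a by auto
    have BB: "B * B\<^sup>T \<in> carrier_mat m m" using B by auto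
    have ww: "a \<bullet> ((B * B\<^sup>T) *\<^sub>v a) = w \<bullet> w"
      using congruence_form[OF B a one_carrier_mat] B w unfolding w_def by simp
    have Gform: "a \<bullet> (G *\<^sub>v a) = \<alpha> * (a \<bullet> a) + w \<bullet> w"
      unfolding G_def using BB a ww by (simp add: shifted_mult_vec scalar_prod_add_distrib[of _ m])
    have Hform: "a \<bullet> (H *\<^sub>v a) = w \<bullet> (inv_mat A *\<^sub>v w)"
      unfolding H_def w_def by (rule congruence_form[OF B a K(1)])
    have "\<alpha> * (\<sigma> * (a \<bullet> a)) \<le> \<alpha> * (w \<bullet> w)" using \<sigma>(2)[OF a] \<alpha> ww by (intro mult_left_mono) auto
    then have "\<sigma> / (\<alpha> + \<sigma>) * (a \<bullet> (G *\<^sub>v a)) \<le> w \<bullet> w"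
      unfolding Gform using \<alpha> \<sigma>(1) by (simp add: field_simps)
    then have "1 / \<mu>_max A * (\<sigma> / (\<alpha> + \<sigma>) * (a \<bullet> (G *\<^sub>v a))) \<le> 1 / \<mu>_max A * (w \<bullet> w)"
      using ex(2) by (intro mult_left_mono) auto
    also have "\<dots> \<le> a \<bullet> (H *\<^sub>v a)" unfolding Hform by (rule inv_mat_form_bounds(1)[OF A n w])
    finally show "\<sigma> / (\<alpha> + \<sigma>) * (1 / \<mu>_max A) * (a \<bullet> (G *\<^sub>v a)) \<le> a \<bullet> (H *\<^sub>v a)"
      by (simp add: ac_simps)
    have "a \<bullet> (H *\<^sub>v a) \<le> 1 / \<mu>_min A * (w \<bullet> w)"
      unfolding Hform by (rule inv_mat_form_bounds(2)[OF A n w])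
    also have "\<dots> \<le> 1 / \<mu>_min A * (a \<bullet> (G *\<^sub>v a))"
      unfolding Gform using ex(1) \<alpha> scalar_prod_self_nonneg[of a] by (intro mult_left_mono) auto
    finally show "a \<bullet> (H *\<^sub>v a) \<le> 1 / \<mu>_min A * (a \<bullet> (G *\<^sub>v a))" .
  qed
  show ?thesis by (rule pencil_eigenvalue_bounds[OF G H forms y eq])
qed

text \<open>As the limit differs from 1, so do the eigenvalues from some index on; from there they are
  eigenvalues of \<open>A_hat\<close> and satisfy its bounds, with a single \<open>\<sigma>\<close> for all \<open>\<alpha>\<close>.\<close>

lemma limit_eigenvalue:
  fixes \<alpha> :: "nat \<Rightarrow> real" and \<mu> :: "nat \<Rightarrow> complex"
  assumes A: "sym_pos_def n A" and n: "n > 0" and B: "B \<in> carrier_mat m n"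
    and rank: "vec_space.rank m B = m"
    and \<alpha>: "\<And>k. \<alpha> k > 0" "\<alpha> \<longlonglongrightarrow> 0"
    and ev: "\<And>k. eigenvalue (precond_mat A B (\<alpha> k)) (\<mu> k)" and lim: "\<mu> \<longlonglongrightarrow> \<mu>'" and ne: "\<mu>' \<noteq> 1"
  shows "\<mu>' \<in> complex_of_real ` {1 / \<mu>_max A .. 1 / \<mu>_min A}"
proof -
  note G = sym_pos_def_gram[OF B rank]
  note D = sym_pos_defD[OF G]
  obtain \<sigma> where \<sigma>: "\<sigma> > 0" "\<And>v. v \<in> carrier_vec m \<Longrightarrow> \<sigma> * (v \<bullet> v) \<le> v \<bullet> ((B * B\<^sup>T) *\<^sub>v v)"
    using coercive_if_psd_and_det_nonzero[OF D(1,2) sym_pos_def_det_nonzero[OF G] D(4)] by blast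
  have "eventually (\<lambda>k. \<mu> k \<noteq> 1) sequentially" using tendsto_imp_eventually_ne[OF lim ne] .
  then have bounds: "eventually (\<lambda>k. Im (\<mu> k) = 0 \<and> \<sigma> / (\<alpha> k + \<sigma>) * (1 / \<mu>_max A) \<le> Re (\<mu> k) \<and>
      Re (\<mu> k) \<le> 1 / \<mu>_min A) sequentially"
  proof eventually_elim
    case (elim k)
    then have "eigenvalue (A_hat A B (\<alpha> k)) (\<mu> k)"
      using eigenvalue_precond_mat_cases[OF A B \<alpha>(1) ev] by blast
    from eigenvalue_A_hat_bounds[OF A n B \<sigma> \<alpha>(1) this] show ?case by auto
  qed
  have "(\<lambda>k. Im (\<mu> k)) \<longlonglongrightarrow> 0"
    using bounds by (intro tendsto_eventually) (auto elim: eventually_mono)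
  then have Im: "Im \<mu>' = 0" using tendsto_Im[OF lim] LIMSEQ_unique by blast
  have "(\<lambda>k. \<sigma> / (\<alpha> k + \<sigma>) * (1 / \<mu>_max A)) \<longlonglongrightarrow> \<sigma> / (0 + \<sigma>) * (1 / \<mu>_max A)"
    using \<sigma>(1) by (intro tendsto_intros \<alpha>(2)) auto
  then have low: "(\<lambda>k. \<sigma> / (\<alpha> k + \<sigma>) * (1 / \<mu>_max A)) \<longlonglongrightarrow> 1 / \<mu>_max A" using \<sigma>(1) by simp
  have "1 / \<mu>_max A \<le> Re \<mu>'"
    using bounds by (intro tendsto_le[OF _ tendsto_Re[OF lim] low]) (auto elim: eventually_mono)
  moreover have "Re \<mu>' \<le> 1 / \<mu>_min A"
    using bounds by (intro tendsto_upperbound[OF tendsto_Re[OF lim]]) (auto elim: eventually_mono)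
  ultimately show ?thesis
    using Im by (intro image_eqI[of _ _ "Re \<mu>'"]) (auto simp: complex_eq_iff)
qed

theorem theorem2:
  fixes A B :: "real mat" and n m :: nat
  assumes "sym_pos_def n A"
    and "B \<in> carrier_mat m n"
    and "vec_space.rank m B = m"
    and "m < n"
  shows "(\<forall>\<alpha>>0.
            alg_mult (precond_mat A B \<alpha>) 1 \<ge> n \<and>
            (\<exists>\<mu>s. length \<mu>s = m \<and>
               eigvals (A_hat A B \<alpha>) = mset \<mu>s \<and>
               eigvals (precond_mat A B \<alpha>) = replicate_mset n 1 + mset \<mu>s))
       \<and> (\<forall>\<alpha>>0. \<forall>\<mu>. \<forall>x \<in> carrier_vec n. \<forall>y \<in> carrier_vec m.
            eigenvector (precond_mat A B \<alpha>) (x @\<^sub>v y) \<mu> \<longrightarrow>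
              x \<noteq> 0\<^sub>v n \<and>
              (\<mu> = 1 \<or>
               a_hat A B \<alpha> x \<noteq> 0 \<and>
               \<mu> = (complex_of_real \<alpha> * b_hat B x + c_hat B x) / a_hat A B \<alpha> x))
       \<and> (\<forall>(\<alpha> :: nat \<Rightarrow> real) (\<mu> :: nat \<Rightarrow> complex) \<mu>'.
            (\<forall>k. \<alpha> k > 0) \<longrightarrow> \<alpha> \<longlonglongrightarrow> 0 \<longrightarrow>
            (\<forall>k. eigenvalue (precond_mat A B (\<alpha> k)) (\<mu> k)) \<longrightarrow>
            \<mu> \<longlonglongrightarrow> \<mu>' \<longrightarrow>
              \<mu>' = 1 \<or> \<mu>' \<in> complex_of_real ` {1 / \<mu>_max A .. 1 / \<mu>_min A})"
proof (intro conjI allI impI ballI)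
  fix \<alpha> :: real assume \<alpha>: "\<alpha> > 0"
  note E = eigvals_precond_mat[OF assms(1,2) \<alpha>]
  show "alg_mult (precond_mat A B \<alpha>) 1 \<ge> n" by (rule E(3))
  obtain \<mu>s where "mset \<mu>s = eigvals (A_hat A B \<alpha>)" using ex_mset by blast
  then show "\<exists>\<mu>s. length \<mu>s = m \<and> eigvals (A_hat A B \<alpha>) = mset \<mu>s \<and>
      eigvals (precond_mat A B \<alpha>) = replicate_mset n 1 + mset \<mu>s"
    using E(1,2) by (intro exI[of _ \<mu>s]) (metis size_mset)
next
  fix \<alpha> :: real and \<mu> x y
  assume H: "\<alpha> > 0" "x \<in> carrier_vec n" "y \<in> carrier_vec m"
    "eigenvector (precond_mat A B \<alpha>) (x @\<^sub>v y) \<mu>"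
  show x: "x \<noteq> 0\<^sub>v n" by (rule eigenvector_precond_mat_fst_nonzero[OF assms(1-3) H])
  show "\<mu> = 1 \<or> a_hat A B \<alpha> x \<noteq> 0 \<and>
      \<mu> = (complex_of_real \<alpha> * b_hat B x + c_hat B x) / a_hat A B \<alpha> x"
    using eigenvalue_formula[OF assms(1,2) H(1,2) x H(3,4)] by blast
next
  fix \<alpha> :: "nat \<Rightarrow> real" and \<mu> :: "nat \<Rightarrow> complex" and \<mu>'
  assume "\<forall>k. \<alpha> k > 0" "\<alpha> \<longlonglongrightarrow> 0" "\<forall>k. eigenvalue (precond_mat A B (\<alpha> k)) (\<mu> k)" "\<mu> \<longlonglongrightarrow> \<mu>'"
  then show "\<mu>' = 1 \<or> \<mu>' \<in> complex_of_real ` {1 / \<mu>_max A .. 1 / \<mu>_min A}"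
    using limit_eigenvalue[OF assms(1) _ assms(2,3), of \<alpha> \<mu> \<mu>'] assms(4) by blast
qed

end
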